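(* Let $d\ge2$, consider the $n$-qudit system $(\mathbb C^d)^{\otimes n}$, let $H$ be a Hamiltonian acting nontrivially only on a $k$-qudit subsystem, and let $|\psi\rangle$ be an $n$-qudit pure state. Then the quantum Wasserstein rate satisfies $R_{W_1}(\psi,H)\le 2\sqrt2\,k\,\|H\|_\infty$, where $\|\cdot\|_\infty$ is the operator norm.
   Context: For $\mathcal H=(\mathbb C^d)^{\otimes n}$, let $O(\mathcal H)$ be the traceless Hermitian operators on $\mathcal H$. For $A\in O(\mathcal H)$, $\|A\|_{W_1}:=\frac12\min\left\{\sum_{i=1}^n\|X_i\|_1 : A=\sum_i X_i,\ X_i\in O(\mathcal H),\ \mathrm{Tr}_i X_i=0\ \forall i\right\}$, with $\mathrm{Tr}_i$ the partial trace over the $i$-th qudit and $\|\cdot\|_1$ the trace norm. With $U_t=\exp(-iHt)$, the quantum Wasserstein rate is $R_{W_1}(\psi,H):=\lim_{\Delta t\to0}\left\|\frac{|\psi\rangle\langle\psi|-U_{\Delta t}|\psi\rangle\langle\psi|U_{\Delta t}^\dagger}{\Delta t}\right\|_{W_1}$. *)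

theory Defs
  imports "Jordan_Normal_Form.Matrix" "Jordan_Normal_Form.Char_Poly"
    "HOL-Computational_Algebra.Polynomial"
begin

text \<open>Operators on the n-qudit space (C^d)^(tensor n) are represented as d^n x d^n complex
  matrices. A basis index a < d^n encodes the multi-index whose i-th qudit value is the
  i-th base-d digit of a.\<close>

definition qdigit :: "nat \<Rightarrow> nat \<Rightarrow> nat \<Rightarrow> nat" where
  "qdigit d i a = (a div d ^ i) mod d"

definition adj :: "complex mat \<Rightarrow> complex mat" where
  "adj A = mat (dim_col A) (dim_row A) (\<lambda>(i,j). cnj (A $$ (j,i)))"

definition hermitian_op :: "nat \<Rightarrow> complex mat \<Rightarrow> bool" where
  "hermitian_op N A \<longleftrightarrow> A \<in> carrier_mat N N \<and> adj A = A"

definition mtrace :: "complex mat \<Rightarrow> complex" where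
  "mtrace A = (\<Sum>i<dim_row A. A $$ (i,i))"

definition traceless_herm :: "nat \<Rightarrow> nat \<Rightarrow> complex mat set" where
  "traceless_herm d n = {A. hermitian_op (d ^ n) A \<and> mtrace A = 0}"

text \<open>Tr_i X = 0: every entry of the partial trace over qudit i vanishes.
  Entries of Tr_i X are indexed by indices a, b with i-th digit 0 (the remaining digits).\<close>
definition ptrace_zero :: "nat \<Rightarrow> nat \<Rightarrow> nat \<Rightarrow> complex mat \<Rightarrow> bool" where
  "ptrace_zero d n i X \<longleftrightarrow>
     (\<forall>a < d ^ n. \<forall>b < d ^ n. qdigit d i a = 0 \<longrightarrow> qdigit d i b = 0 \<longrightarrow>
        (\<Sum>j<d. X $$ (a + j * d ^ i, b + j * d ^ i)) = 0)"

definition trace_norm :: "complex mat \<Rightarrow> real" where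
  "trace_norm X = sum_mset (image_mset (\<lambda>z. sqrt (Re z)) (proots (char_poly (adj X * X))))"

definition vnorm :: "complex vec \<Rightarrow> real" where
  "vnorm v = sqrt (\<Sum>i<dim_vec v. (cmod (v $ i))\<^sup>2)"

definition op_norm :: "complex mat \<Rightarrow> real" where
  "op_norm A = Sup {vnorm (A *\<^sub>v v) | v. v \<in> carrier_vec (dim_col A) \<and> vnorm v = 1}"

definition W1_norm :: "nat \<Rightarrow> nat \<Rightarrow> complex mat \<Rightarrow> real" where
  "W1_norm d n A = (1/2) * Inf {(\<Sum>i<n. trace_norm (X i)) | X.
      (\<forall>i<n. X i \<in> traceless_herm d n \<and> ptrace_zero d n i (X i)) \<and>
      (\<forall>a < d ^ n. \<forall>b < d ^ n. A $$ (a, b) = (\<Sum>i<n. X i $$ (a, b)))}"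

definition mat_exp :: "complex mat \<Rightarrow> complex mat" where
  "mat_exp A = mat (dim_row A) (dim_col A)
     (\<lambda>(i,j). \<Sum>m. (A ^\<^sub>m m) $$ (i,j) / of_nat (fact m))"

definition proj :: "complex vec \<Rightarrow> complex mat" where
  "proj v = mat (dim_vec v) (dim_vec v) (\<lambda>(i,j). v $ i * cnj (v $ j))"

definition evol :: "complex mat \<Rightarrow> real \<Rightarrow> complex mat" where
  "evol H t = mat_exp ((- \<i> * of_real t) \<cdot>\<^sub>m H)"

definition W1_rate :: "nat \<Rightarrow> nat \<Rightarrow> complex vec \<Rightarrow> complex mat \<Rightarrow> real" where
  "W1_rate d n psi H = Lim (at (0::real))
     (\<lambda>t. W1_norm d n ((1 / of_real t) \<cdot>\<^sub>m (proj psi - evol H t * proj psi * adj (evol H t))))"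

text \<open>H acts nontrivially only on the qudits in S, i.e. H = h_S \<otimes> I_{S^c}:
  entries vanish unless the digits outside S agree, and otherwise depend only on the
  digits in S.\<close>
definition acts_only_on :: "nat \<Rightarrow> nat \<Rightarrow> nat set \<Rightarrow> complex mat \<Rightarrow> bool" where
  "acts_only_on d n S H \<longleftrightarrow>
     (\<forall>a < d ^ n. \<forall>b < d ^ n.
        (\<exists>i<n. i \<notin> S \<and> qdigit d i a \<noteq> qdigit d i b) \<longrightarrow> H $$ (a, b) = 0) \<and>
     (\<forall>a < d ^ n. \<forall>b < d ^ n. \<forall>a' < d ^ n. \<forall>b' < d ^ n.
        (\<forall>i<n. i \<notin> S \<longrightarrow> qdigit d i a = qdigit d i b \<and> qdigit d i a' = qdigit d i b') \<longrightarrow>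
        (\<forall>i\<in>S. qdigit d i a = qdigit d i a' \<and> qdigit d i b = qdigit d i b') \<longrightarrow>
        H $$ (a, b) = H $$ (a', b'))"

end

theory Submission
  imports Defs "Jordan_Normal_Form.Schur_Decomposition"
begin

text \<open>The difference quotients converge entrywise to \<open>A = \<i> [H, |\<psi>\<rangle>\<langle>\<psi>|]\<close>, and the Wasserstein norm
  is subadditive and bounded by a multiple of the entries on traceless Hermitian matrices, so the
  rate is the norm of \<open>A\<close>. Depolarizing the qudits of \<open>S\<close> one after the other writes \<open>A\<close> as a
  telescoping sum of \<open>k\<close> matrices, each with a vanishing partial trace; it ends in \<open>0\<close> because \<open>H\<close>
  acts only on \<open>S\<close>. Depolarization does not increase the trace norm, so the norm of \<open>A\<close> is at most
  \<open>k\<close> times its trace norm, which is at most twice the operator norm of \<open>H\<close>.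
  The trace norm of a Hermitian matrix enters only through its variational form: it is the least
  value of \<open>tr P + tr Q\<close> over all decompositions into a difference \<open>P - Q\<close> of matrices whose
  quadratic form has nonnegative real part.\<close>

section \<open>Spectral theorem and trace norm\<close>

text \<open>\<open>trace_norm\<close> is defined through the roots of a characteristic polynomial, a
  form in which neither sums nor linear maps can be followed. In the variational form both are easy:
  decompositions add, and a positive trace-preserving map carries a decomposition to one of equal
  cost. Two conventions force existence proofs: \<open>Inf\<close> over the reals is informative
  only for a nonempty set bounded below, and \<open>Lim\<close> only once convergence is known.
  Depolarizing all \<open>n\<close> qudits annihilates a traceless matrix, so the same telescoping
  sum supplies a feasible family for every traceless Hermitian matrix, and with it the continuity
  behind the limit. As for the constant, each telescoping difference costs at most twice the trace
  norm of \<open>A\<close>, the factor one half in the Wasserstein norm cancels this two, and the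
  rank-two shape of \<open>A\<close> costs at most twice the operator norm of \<open>H\<close>. The
  result is \<open>2 * k\<close> times that norm, which the factor \<open>sqrt 2\<close>
  enlarges.\<close>

lemma hermitian_op_cnj:
  assumes "hermitian_op N X" "i < N" "j < N"
  shows "cnj (X $$ (i, j)) = X $$ (j, i)"
proof -
  have X: "X \<in> carrier_mat N N" and "adj X = X"
    using assms by (auto simp: hermitian_op_def)
  then have "X $$ (j, i) = adj X $$ (j, i)" by simp
  also have "\<dots> = cnj (X $$ (i, j))"
    using X assms unfolding adj_def by (subst index_mat) auto
  finally show ?thesis ..
qed

lemma hermitian_opI:
  assumes "\<And>i j. i < N \<Longrightarrow> j < N \<Longrightarrow> cnj (f j i) = f i j"
  shows "hermitian_op N (mat N N (\<lambda>(i, j). f i j))"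
  using assms unfolding hermitian_op_def adj_def by (auto intro!: eq_matI)

lemma mult_mat_vec_nth:
  assumes "X \<in> carrier_mat N N" "v \<in> carrier_vec N" "i < N"
  shows "(X *\<^sub>v v) $ i = (\<Sum>j<N. X $$ (i, j) * v $ j)"
  using assms by (auto simp: scalar_prod_def atLeast0LessThan intro!: sum.cong)

lemma mult_mat_nth:
  assumes "A \<in> carrier_mat N N" "B \<in> carrier_mat N N" "i < N" "j < N"
  shows "(A * B) $$ (i, j) = (\<Sum>k<N. A $$ (i, k) * B $$ (k, j))"
  using assms by (auto simp: scalar_prod_def atLeast0LessThan intro!: sum.cong)

lemma mtrace_mult_commute:
  assumes "A \<in> carrier_mat N N" "B \<in> carrier_mat N N"
  shows "mtrace (A * B) = mtrace (B * A)"
proof -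
  have "mtrace (A * B) = (\<Sum>i<N. \<Sum>k<N. A $$ (i, k) * B $$ (k, i))"
    using assms mult_mat_nth[OF assms] by (auto simp: mtrace_def intro!: sum.cong)
  also have "\<dots> = (\<Sum>k<N. \<Sum>i<N. B $$ (k, i) * A $$ (i, k))"
    by (subst sum.swap) (simp add: mult.commute)
  also have "\<dots> = mtrace (B * A)"
    using assms mult_mat_nth[OF assms(2,1)] by (auto simp: mtrace_def intro!: sum.cong)
  finally show ?thesis .
qed

text \<open>Schur triangularization preserves the trace and puts eigenvalues on the diagonal. Read
  contrapositively, a trace other than \<open>N * z\<close> produces an eigenvalue other than
  \<open>z\<close>.\<close>

lemma all_eigenvalues_eq_imp_mtrace:
  fixes Y :: "complex mat"
  assumes Y: "Y \<in> carrier_mat N N"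
    and ev: "\<And>e. eigenvalue Y e \<Longrightarrow> e = z"
  shows "mtrace Y = of_nat N * z"
proof -
  obtain es where es: "char_poly Y = (\<Prod>a\<leftarrow>es. [:- a, 1:])" "length es = N"
    using char_poly_factorized[OF Y] by blast
  obtain B P Q where "schur_decomposition Y es = (B, P, Q)"
    by (cases "schur_decomposition Y es")
  from schur_decomposition[OF Y es(1) this]
  have sim: "similar_mat_wit Y B P Q" and diag: "diag_mat B = es" by auto
  from similar_mat_witD2[OF Y sim] have car: "B \<in> carrier_mat N N" "P \<in> carrier_mat N N"
    "Q \<in> carrier_mat N N" and QP: "Q * P = 1\<^sub>m N" and YPB: "Y = P * B * Q" by auto
  have "mtrace Y = mtrace (Q * (P * B))"
    unfolding YPB using car by (intro mtrace_mult_commute[of _ N]) auto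
  also have "Q * (P * B) = B"
    using car QP by (metis assoc_mult_mat left_mult_one_mat)
  also have "mtrace B = (\<Sum>i<N. z)"
    unfolding mtrace_def
  proof (rule sum.cong)
    fix i assume "i \<in> {..<N}"
    then have "B $$ (i, i) \<in> set es"
      using diag car by (auto simp: diag_mat_def)
    then have "poly (char_poly Y) (B $$ (i, i)) = 0"
      unfolding es(1) by (auto simp: poly_prod_list prod_list_zero_iff)
    then show "B $$ (i, i) = z"
      using ev eigenvalue_root_char_poly[OF Y] by blast
  qed (use car in auto)
  finally show ?thesis by simp
qed

text \<open>The count \<open>m\<close> makes this the invariant of an induction;
  \<open>m = N\<close> gives an orthonormal eigenbasis.\<close>

definition orthonormal_eigenvectors ::
  "nat \<Rightarrow> complex mat \<Rightarrow> nat \<Rightarrow> (nat \<Rightarrow> nat \<Rightarrow> complex) \<Rightarrow> (nat \<Rightarrow> real) \<Rightarrow> bool" where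
  "orthonormal_eigenvectors N X m v l \<longleftrightarrow>
     (\<forall>k<m. \<forall>k'<m. (\<Sum>i<N. cnj (v k i) * v k' i) = of_bool (k = k')) \<and>
     (\<forall>k<m. \<forall>i<N. (\<Sum>j<N. X $$ (i, j) * v k j) = of_real (l k) * v k i)"

lemma sum_cnj_mult_self: "(\<Sum>i\<in>A. cnj (u i) * u i) = of_real (\<Sum>i\<in>A. (cmod (u i))\<^sup>2)"
  by (simp add: complex_norm_square mult.commute del: of_real_power)

text \<open>The form \<open>q\<close> is its own conjugate by Hermiticity, and it equals
  \<open>z\<close> times the nonzero squared norm of \<open>u\<close>.\<close>

lemma hermitian_eigenvalue_real:
  assumes X: "hermitian_op N X"
    and u: "\<And>i. i < N \<Longrightarrow> (\<Sum>j<N. X $$ (i, j) * u j) = z * u i"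
    and "(\<Sum>i<N. (cmod (u i))\<^sup>2) \<noteq> 0"
  shows "z \<in> \<real>"
proof -
  define r where "r = (\<Sum>i<N. (cmod (u i))\<^sup>2)"
  define q where "q = (\<Sum>i<N. cnj (u i) * (\<Sum>j<N. X $$ (i, j) * u j))"
  have "q = (\<Sum>i<N. cnj (u i) * (z * u i))"
    unfolding q_def using u by (intro sum.cong) auto
  also have "\<dots> = z * (\<Sum>i<N. cnj (u i) * u i)"
    by (simp add: sum_distrib_left mult_ac)
  finally have q: "q = z * of_real r" by (simp add: sum_cnj_mult_self r_def)
  have "cnj q = (\<Sum>i<N. \<Sum>j<N. u i * (X $$ (j, i) * cnj (u j)))"
    unfolding q_def using hermitian_op_cnj[OF X] by (simp add: sum_distrib_left)
  also have "\<dots> = q"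
    unfolding q_def by (subst sum.swap) (simp add: sum_distrib_left mult_ac)
  finally have "q \<in> \<real>" by (simp add: Reals_cnj_iff)
  then have "q / of_real r \<in> \<real>" by (auto intro: Reals_divide)
  then show ?thesis using assms(3) q by (simp add: r_def[symmetric])
qed

text \<open>Replacing \<open>X\<close> by \<open>\<i>\<close> on the span of the eigenvectors found so far gives a matrix \<open>Y\<close>
  whose eigenvectors for eigenvalues other than \<open>\<i>\<close> are eigenvectors of \<open>X\<close> orthogonal to that
  span; the imaginary part of the trace of \<open>Y\<close> shows that there is such an eigenvalue.\<close>

lemma orthonormal_eigenvectors_extend:
  assumes X: "hermitian_op N X" and v: "orthonormal_eigenvectors N X m v l" and "m < N"
  shows "\<exists>v' l'. orthonormal_eigenvectors N X (Suc m) v' l'"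
proof -
  have Xc: "X \<in> carrier_mat N N" using X by (simp add: hermitian_op_def)
  have orth: "\<And>k k'. k < m \<Longrightarrow> k' < m \<Longrightarrow> (\<Sum>i<N. cnj (v k i) * v k' i) = of_bool (k = k')"
    and eig: "\<And>k i. k < m \<Longrightarrow> i < N \<Longrightarrow> (\<Sum>j<N. X $$ (i, j) * v k j) = of_real (l k) * v k i"
    using v by (auto simp: orthonormal_eigenvectors_def)
  define y where "y i j = X $$ (i, j) + (\<Sum>k<m. (\<i> - of_real (l k)) * v k i * cnj (v k j))" for i j
  define Y where "Y = mat N N (\<lambda>(i, j). y i j)"
  have Yc: "Y \<in> carrier_mat N N" by (simp add: Y_def)
  have "mtrace Y = (\<Sum>i<N. X $$ (i, i)) + (\<Sum>i<N. \<Sum>k<m. (\<i> - of_real (l k)) * v k i * cnj (v k i))"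
    by (simp add: mtrace_def Y_def y_def sum.distrib)
  also have "(\<Sum>i<N. \<Sum>k<m. (\<i> - of_real (l k)) * v k i * cnj (v k i)) =
      (\<Sum>k<m. (\<i> - of_real (l k)) * (\<Sum>i<N. cnj (v k i) * v k i))"
    by (subst sum.swap) (simp add: sum_distrib_left mult_ac)
  also have "\<dots> = (\<Sum>k<m. \<i> - of_real (l k))"
    using orth by simp
  finally have "Im (mtrace Y) = (\<Sum>i<N. Im (X $$ (i, i))) + real m"
    by simp
  moreover have "Im (X $$ (i, i)) = 0" if "i < N" for i
    using hermitian_op_cnj[OF X that that] by (simp add: complex_eq_iff)
  ultimately have "mtrace Y \<noteq> of_nat N * \<i>"
    using \<open>m < N\<close> by (auto simp: complex_eq_iff)
  then obtain z where z: "eigenvalue Y z" "z \<noteq> \<i>"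
    using all_eigenvalues_eq_imp_mtrace[OF Yc] by blast
  then obtain w where w: "w \<in> carrier_vec N" "w \<noteq> 0\<^sub>v N" "Y *\<^sub>v w = z \<cdot>\<^sub>v w"
    using Yc by (auto simp: eigenvalue_def eigenvector_def)
  define u where "u i = w $ i" for i
  have Yu: "(\<Sum>j<N. y i j * u j) = z * u i" if "i < N" for i
  proof -
    have "z * u i = (Y *\<^sub>v w) $ i"
      unfolding w(3) using that w(1) by (simp add: u_def)
    also have "\<dots> = (\<Sum>j<N. Y $$ (i, j) * w $ j)"
      by (rule mult_mat_vec_nth[OF Yc w(1) that])
    finally show ?thesis
      using that by (simp add: Y_def u_def)
  qed
  have Yu_eq: "(\<Sum>j<N. y i j * u j) = (\<Sum>j<N. X $$ (i, j) * u j) +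
      (\<Sum>k<m. (\<i> - of_real (l k)) * v k i * (\<Sum>j<N. cnj (v k j) * u j))" for i
  proof -
    have "(\<Sum>j<N. y i j * u j) = (\<Sum>j<N. X $$ (i, j) * u j) +
      (\<Sum>j<N. \<Sum>k<m. (\<i> - of_real (l k)) * v k i * (cnj (v k j) * u j))"
      by (simp add: y_def distrib_right sum.distrib sum_distrib_right mult.assoc)
    also have "(\<Sum>j<N. \<Sum>k<m. (\<i> - of_real (l k)) * v k i * (cnj (v k j) * u j)) =
      (\<Sum>k<m. (\<i> - of_real (l k)) * v k i * (\<Sum>j<N. cnj (v k j) * u j))"
      unfolding sum_distrib_left by (rule sum.swap)
    finally show ?thesis .
  qed
  \<comment> \<open>Pairing the eigenvalue equation of \<open>Y\<close> with \<open>v k\<close>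
    gives \<open>z * p k = l k * p k + (\<i> - l k) * p k\<close>, so the \<open>l k\<close> cancel
    and \<open>z \<noteq> \<i>\<close> forces \<open>p k = 0\<close>.\<close>
  have perp: "(\<Sum>j<N. cnj (v k j) * u j) = 0" if k: "k < m" for k
  proof -
    define p where "p k' = (\<Sum>j<N. cnj (v k' j) * u j)" for k'
    have "z * p k = (\<Sum>i<N. cnj (v k i) * (\<Sum>j<N. y i j * u j))"
      using Yu by (simp add: p_def sum_distrib_left mult_ac)
    also have "\<dots> = (\<Sum>i<N. cnj (v k i) * (\<Sum>j<N. X $$ (i, j) * u j)) +
        (\<Sum>i<N. cnj (v k i) * (\<Sum>k'<m. (\<i> - of_real (l k')) * v k' i * p k'))"
      unfolding Yu_eq p_def by (simp add: distrib_left sum.distrib)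
    also have "(\<Sum>i<N. cnj (v k i) * (\<Sum>k'<m. (\<i> - of_real (l k')) * v k' i * p k')) =
        (\<Sum>k'<m. (\<i> - of_real (l k')) * p k' * (\<Sum>i<N. cnj (v k i) * v k' i))"
      unfolding sum_distrib_left by (subst sum.swap) (simp add: mult_ac)
    also have "\<dots> = (\<Sum>k'<m. (\<i> - of_real (l k')) * p k' * of_bool (k = k'))"
      using k by (intro sum.cong refl) (simp only: orth lessThan_iff)
    also have "\<dots> = (\<i> - of_real (l k)) * p k"
      using k by (simp add: of_bool_def if_distrib cong: if_cong)
    also have "(\<Sum>i<N. cnj (v k i) * (\<Sum>j<N. X $$ (i, j) * u j)) =
        (\<Sum>j<N. cnj (\<Sum>i<N. X $$ (j, i) * v k i) * u j)"
      unfolding sum_distrib_left cnj_sum sum_distrib_right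
      by (subst sum.swap) (use hermitian_op_cnj[OF X] in \<open>simp add: mult_ac\<close>)
    also have "\<dots> = of_real (l k) * p k"
      using eig[OF k] by (simp add: p_def sum_distrib_left mult_ac)
    finally have "(z - \<i>) * p k = 0" by (simp add: algebra_simps)
    then show ?thesis using z by (simp add: p_def)
  qed
  have Xu: "(\<Sum>j<N. X $$ (i, j) * u j) = z * u i" if "i < N" for i
    using Yu[OF that] Yu_eq[of i] perp by simp
  define r where "r = (\<Sum>i<N. (cmod (u i))\<^sup>2)"
  have "\<exists>i<N. u i \<noteq> 0"
    using w unfolding u_def by (auto intro!: eq_vecI)
  then have "r > 0"
    unfolding r_def by (auto intro!: sum_pos2)
  then have "z \<in> \<real>"
    using hermitian_eigenvalue_real[OF X Xu] by (simp add: r_def)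
  then obtain e where e: "z = of_real e" by (auto elim: Reals_cases)
  define u' where "u' i = u i / of_real (sqrt r)" for i
  have norm: "(\<Sum>i<N. cnj (u' i) * u' i) = 1"
  proof -
    have "(\<Sum>i<N. cnj (u' i) * u' i) = (\<Sum>i<N. cnj (u i) * u i) / (of_real (sqrt r) * of_real (sqrt r))"
      unfolding u'_def by (simp add: sum_divide_distrib)
    also have "complex_of_real (sqrt r) * of_real (sqrt r) = of_real r"
      using \<open>r > 0\<close> by (simp flip: of_real_mult)
    also have "(\<Sum>i<N. cnj (u i) * u i) = of_real r"
      unfolding r_def by (rule sum_cnj_mult_self)
    finally show ?thesis
      using \<open>r > 0\<close> by simp
  qed
  have perp': "(\<Sum>i<N. cnj (v k i) * u' i) = 0" if "k < m" for k
    using perp[OF that] by (simp add: u'_def sum_divide_distrib[symmetric])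
  have perp'': "(\<Sum>i<N. cnj (u' i) * v k i) = 0" if "k < m" for k
    using arg_cong[OF perp'[OF that], of cnj] by (simp add: mult.commute)
  have Xu': "(\<Sum>j<N. X $$ (i, j) * u' j) = of_real e * u' i" if "i < N" for i
    using Xu[OF that] by (simp add: u'_def e sum_divide_distrib[symmetric])
  have "orthonormal_eigenvectors N X (Suc m) (v(m := u')) (l(m := e))"
    using orth eig norm perp' perp'' Xu'
    by (auto simp: orthonormal_eigenvectors_def less_Suc_eq)
  then show ?thesis by blast
qed

lemma hermitian_spectral:
  assumes X: "hermitian_op N X"
  obtains v l where "orthonormal_eigenvectors N X N v l"
proof -
  have "\<exists>v l. orthonormal_eigenvectors N X m v l" if "m \<le> N" for m
    using that
  proof (induction m)
    case 0
    show ?case by (simp add: orthonormal_eigenvectors_def)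
  next
    case (Suc m)
    then show ?case using orthonormal_eigenvectors_extend[OF X, of m] by auto
  qed
  then show ?thesis using that by blast
qed

text \<open>Orthonormality says \<open>W * V = 1\<close>. A one-sided inverse of a square matrix is
  two-sided, and \<open>V * W = 1\<close> is the resolution of the identity.\<close>

lemma orthonormal_eigenvectors_complete:
  assumes v: "orthonormal_eigenvectors N X N v l" and "i < N" "j < N"
  shows "(\<Sum>k<N. v k i * cnj (v k j)) = of_bool (i = j)"
proof -
  define V where "V = mat N N (\<lambda>(i, k). v k i)"
  define W where "W = mat N N (\<lambda>(k, i). cnj (v k i))"
  have c: "V \<in> carrier_mat N N" "W \<in> carrier_mat N N" by (auto simp: V_def W_def)
  have "W * V = 1\<^sub>m N"
  proof (rule eq_matI)
    fix a b assume ab: "a < dim_row (1\<^sub>m N :: complex mat)" "b < dim_col (1\<^sub>m N :: complex mat)"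
    then show "(W * V) $$ (a, b) = 1\<^sub>m N $$ (a, b)"
      using v mult_mat_nth[OF c(2,1), of a b]
      by (auto simp: V_def W_def orthonormal_eigenvectors_def)
  qed (use c in auto)
  then have "V * W = 1\<^sub>m N" by (rule mat_mult_left_right_inverse[OF c(2,1)])
  then have "of_bool (i = j) = (V * W) $$ (i, j)"
    using assms(2,3) by simp
  also have "\<dots> = (\<Sum>k<N. v k i * cnj (v k j))"
    using mult_mat_nth[OF c assms(2,3)] assms(2,3) by (simp add: V_def W_def)
  finally show ?thesis ..
qed

text \<open>The eigenvector matrix conjugates \<open>X * X\<close> to the diagonal matrix of the
  \<open>(l k)\<^sup>2\<close>. Similar matrices have the same characteristic polynomial, hence the
  same roots with multiplicity, and the square roots are \<open>\<bar>l k\<bar>\<close>.\<close>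

lemma trace_norm_spectral:
  assumes X: "hermitian_op N X" and v: "orthonormal_eigenvectors N X N v l"
  shows "trace_norm X = (\<Sum>k<N. \<bar>l k\<bar>)"
proof -
  have Xc: "X \<in> carrier_mat N N" and adj: "adj X = X" using X by (auto simp: hermitian_op_def)
  define V where "V = mat N N (\<lambda>(i, k). v k i)"
  define W where "W = mat N N (\<lambda>(k, i). cnj (v k i))"
  define L where "L = mat N N (\<lambda>(i, j). if i = j then complex_of_real (l i) else 0)"
  define L2 where "L2 = mat N N (\<lambda>(i, j). if i = j then complex_of_real ((l i)\<^sup>2) else 0)"
  have c: "V \<in> carrier_mat N N" "W \<in> carrier_mat N N" "L \<in> carrier_mat N N" "L2 \<in> carrier_mat N N"
    by (auto simp: V_def W_def L_def L2_def)
  have WV: "W * V = 1\<^sub>m N"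
  proof (rule eq_matI)
    fix a b assume ab: "a < dim_row (1\<^sub>m N :: complex mat)" "b < dim_col (1\<^sub>m N :: complex mat)"
    then show "(W * V) $$ (a, b) = 1\<^sub>m N $$ (a, b)"
      using v mult_mat_nth[OF c(2,1), of a b]
      by (auto simp: V_def W_def orthonormal_eigenvectors_def)
  qed (use c in auto)
  then have VW: "V * W = 1\<^sub>m N" by (rule mat_mult_left_right_inverse[OF c(2,1)])
  have XV: "X * V = V * L"
  proof (rule eq_matI)
    fix a b assume "a < dim_row (V * L)" "b < dim_col (V * L)"
    then have ab: "a < N" "b < N" using c by auto
    have "(V * L) $$ (a, b) = (\<Sum>k<N. v k a * (if k = b then of_real (l k) else 0))"
      using ab mult_mat_nth[OF c(1,3) ab] by (simp add: V_def L_def)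
    also have "\<dots> = v b a * of_real (l b)" using ab by (simp add: if_distrib cong: if_cong)
    also have "\<dots> = (\<Sum>j<N. X $$ (a, j) * v b j)"
      using v ab by (simp add: orthonormal_eigenvectors_def mult.commute)
    also have "\<dots> = (X * V) $$ (a, b)"
      using ab mult_mat_nth[OF Xc c(1) ab] by (simp add: V_def)
    finally show "(X * V) $$ (a, b) = (V * L) $$ (a, b)" ..
  qed (use c Xc in auto)
  have LL: "L * L = L2"
  proof (rule eq_matI)
    fix a b assume "a < dim_row L2" "b < dim_col L2"
    then have ab: "a < N" "b < N" using c by auto
    show "(L * L) $$ (a, b) = L2 $$ (a, b)"
      using ab unfolding mult_mat_nth[OF c(3,3) ab]
      by (simp add: L_def L2_def power2_eq_square if_distrib cong: if_cong)
  qed (use c in auto)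
  have XVLW: "X = V * L * W"
  proof -
    have "V * L * W = X * (V * W)" using c Xc by (simp add: XV[symmetric] assoc_mult_mat[of _ N N _ N _ N])
    then show ?thesis using VW Xc by simp
  qed
  have "X * X = X * (V * L * W)" using XVLW by simp
  also have "\<dots> = (X * V) * L * W"
    using c Xc by (simp add: assoc_mult_mat[of _ N N _ N _ N])
  also have "\<dots> = V * L2 * W"
    unfolding XV LL[symmetric] using c by (simp add: assoc_mult_mat[of _ N N _ N _ N])
  finally have "X * X = V * L2 * W" .
  then have "similar_mat (X * X) L2"
    using c Xc WV VW by (intro similar_matI[of _ _ V W N]) auto
  then have "char_poly (X * X) = char_poly L2" by (rule char_poly_similar)
  also have "\<dots> = (\<Prod>a\<leftarrow>diag_mat L2. [:- a, 1:])"
    using c by (intro char_poly_upper_triangular) (auto simp: L2_def)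
  finally have "proots (char_poly (X * X)) = (\<Sum>p\<leftarrow>map (\<lambda>a. [:- a, 1:]) (diag_mat L2). proots p)"
    by (subst proots_prod_list[symmetric]) auto
  also have "(\<Sum>p\<leftarrow>map (\<lambda>a. [:- a, 1:]) xs. proots p) = mset xs" for xs :: "complex list"
    by (induction xs) auto
  finally have "trace_norm X = sum_list (map (\<lambda>z. sqrt (Re z)) (diag_mat L2))"
    by (simp add: trace_norm_def adj flip: mset_map sum_mset_sum_list)
  also have "\<dots> = (\<Sum>k<N. \<bar>l k\<bar>)"
    by (simp add: diag_mat_def L2_def o_def interv_sum_list_conv_sum_set_nat atLeast0LessThan
        flip: of_real_power)
  finally show ?thesis .
qed

section \<open>Quadratic forms and the variational trace norm\<close>

definition quad :: "nat \<Rightarrow> (nat \<Rightarrow> nat \<Rightarrow> complex) \<Rightarrow> (nat \<Rightarrow> complex) \<Rightarrow> complex" where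
  "quad N f v = (\<Sum>a<N. \<Sum>b<N. cnj (v a) * f a b * v b)"

text \<open>Equivalently, the Hermitian part of \<open>f\<close> is positive semidefinite. Asking
  only for the real part leaves no Hermiticity condition to maintain when such matrices are added or
  depolarized.\<close>

definition accretive :: "nat \<Rightarrow> (nat \<Rightarrow> nat \<Rightarrow> complex) \<Rightarrow> bool" where
  "accretive N f \<longleftrightarrow> (\<forall>v. 0 \<le> Re (quad N f v))"

lemma accretive_add: "accretive N f \<Longrightarrow> accretive N g \<Longrightarrow> accretive N (\<lambda>a b. f a b + g a b)"
  by (simp add: accretive_def quad_def algebra_simps sum.distrib)

text \<open>The form at \<open>v\<close> is the sum of \<open>r k\<close> times the squared modulus
  of the inner product of \<open>u k\<close> with \<open>v\<close>.\<close>

lemma accretive_spectral: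
  assumes "\<And>k. k \<in> K \<Longrightarrow> 0 \<le> r k"
  shows "accretive N (\<lambda>a b. \<Sum>k\<in>K. of_real (r k) * u k a * cnj (u k b))"
  unfolding accretive_def
proof
  fix v
  have "quad N (\<lambda>a b. \<Sum>k\<in>K. of_real (r k) * u k a * cnj (u k b)) v =
      (\<Sum>a<N. \<Sum>b<N. \<Sum>k\<in>K. of_real (r k) * ((cnj (v a) * u k a) * (cnj (u k b) * v b)))"
    by (simp add: quad_def sum_distrib_left sum_distrib_right mult_ac)
  also have "\<dots> = (\<Sum>k\<in>K. of_real (r k) * (\<Sum>a<N. \<Sum>b<N. (cnj (v a) * u k a) * (cnj (u k b) * v b)))"
    by (subst sum.swap[where B = K], subst sum.swap[where B = K]) (simp add: sum_distrib_left)
  also have "\<dots> = (\<Sum>k\<in>K. of_real (r k) * (cnj (\<Sum>b<N. cnj (u k b) * v b) * (\<Sum>b<N. cnj (u k b) * v b)))"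
    unfolding sum_product[symmetric] by (simp add: mult.commute)
  also have "\<dots> = of_real (\<Sum>k\<in>K. r k * (cmod (\<Sum>b<N. cnj (u k b) * v b))\<^sup>2)"
    by (simp add: complex_norm_square mult.commute del: of_real_power)
  finally show "0 \<le> Re (quad N (\<lambda>a b. \<Sum>k\<in>K. of_real (r k) * u k a * cnj (u k b)) v)"
    using assms by (auto intro!: sum_nonneg)
qed

text \<open>A relation between a matrix and an upper bound, not an infimum: estimates are
  transported by transforming witnesses, with no question of attainment.\<close>

definition split_bound :: "nat \<Rightarrow> (nat \<Rightarrow> nat \<Rightarrow> complex) \<Rightarrow> real \<Rightarrow> bool" where
  "split_bound N f t \<longleftrightarrow> (\<exists>P Q. accretive N P \<and> accretive N Q \<and>
     (\<forall>a<N. \<forall>b<N. f a b = P a b - Q a b) \<and> (\<Sum>a<N. Re (P a a) + Re (Q a a)) \<le> t)"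

lemma trace_norm_le_iff:
  assumes X: "hermitian_op N X"
  shows "trace_norm X \<le> t \<longleftrightarrow> split_bound N (\<lambda>a b. X $$ (a, b)) t"
proof -
  obtain v l where v: "orthonormal_eigenvectors N X N v l" using hermitian_spectral[OF X] .
  have orth: "\<And>k k'. k < N \<Longrightarrow> k' < N \<Longrightarrow> (\<Sum>i<N. cnj (v k i) * v k' i) = of_bool (k = k')"
    and eig: "\<And>k i. k < N \<Longrightarrow> i < N \<Longrightarrow> (\<Sum>j<N. X $$ (i, j) * v k j) = of_real (l k) * v k i"
    using v by (auto simp: orthonormal_eigenvectors_def)
  note complete = orthonormal_eigenvectors_complete[OF v]
  note tn = trace_norm_spectral[OF X v]
  show ?thesis
  proof
    assume le: "trace_norm X \<le> t"
    \<comment> \<open>The positive and negative spectral parts of \<open>X\<close>; their sum is the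
      absolute value of \<open>X\<close>, whose trace is the sum of the
      \<open>\<bar>l k\<bar>\<close>.\<close>
    define P where "P a b = (\<Sum>k<N. of_real (max (l k) 0) * v k a * cnj (v k b))" for a b
    define Q where "Q a b = (\<Sum>k<N. of_real (max (- l k) 0) * v k a * cnj (v k b))" for a b
    have acc: "accretive N P" "accretive N Q"
      unfolding P_def[abs_def] Q_def[abs_def] by (rule accretive_spectral; simp)+
    have "X $$ (a, b) = P a b - Q a b" if "a < N" "b < N" for a b
    proof -
      have "P a b - Q a b = (\<Sum>k<N. of_real (l k) * v k a * cnj (v k b))"
        unfolding P_def Q_def sum_subtractf[symmetric]
        by (intro sum.cong) (auto simp: max_def algebra_simps)
      also have "\<dots> = (\<Sum>k<N. (\<Sum>j<N. X $$ (a, j) * v k j) * cnj (v k b))"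
        using eig that by simp
      also have "\<dots> = (\<Sum>j<N. X $$ (a, j) * (\<Sum>k<N. v k j * cnj (v k b)))"
        unfolding sum_distrib_right sum_distrib_left by (subst sum.swap) (simp add: mult_ac)
      also have "\<dots> = (\<Sum>j<N. X $$ (a, j) * of_bool (j = b))"
        using that by (intro sum.cong refl) (simp only: complete lessThan_iff)
      also have "\<dots> = X $$ (a, b)"
        using that by (simp add: of_bool_def if_distrib cong: if_cong)
      finally show ?thesis ..
    qed
    moreover have "(\<Sum>a<N. Re (P a a) + Re (Q a a)) = (\<Sum>k<N. \<bar>l k\<bar>)"
    proof -
      have "(\<Sum>a<N. P a a + Q a a) = (\<Sum>a<N. \<Sum>k<N. of_real \<bar>l k\<bar> * (cnj (v k a) * v k a))"
        unfolding P_def Q_def sum.distrib[symmetric]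
        by (intro sum.cong refl) (auto simp: max_def)
      also have "\<dots> = (\<Sum>k<N. of_real \<bar>l k\<bar> * (\<Sum>a<N. cnj (v k a) * v k a))"
        by (subst sum.swap) (simp add: sum_distrib_left)
      also have "\<dots> = of_real (\<Sum>k<N. \<bar>l k\<bar>)" using orth by simp
      finally show ?thesis by (simp add: complex_eq_iff sum.distrib)
    qed
    ultimately show "split_bound N (\<lambda>a b. X $$ (a, b)) t"
      unfolding split_bound_def using acc le tn by (intro exI[of _ P] exI[of _ Q]) auto
  next
    assume "split_bound N (\<lambda>a b. X $$ (a, b)) t"
    then obtain P Q where acc: "accretive N P" "accretive N Q"
      and X_eq: "\<And>a b. a < N \<Longrightarrow> b < N \<Longrightarrow> X $$ (a, b) = P a b - Q a b"
      and le: "(\<Sum>a<N. Re (P a a) + Re (Q a a)) \<le> t"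
      unfolding split_bound_def by auto
    \<comment> \<open>The trace can be computed in the eigenbasis, which is how bounds on the single
      \<open>l k\<close> reach the diagonals of \<open>P\<close> and \<open>Q\<close>.\<close>
    have tr: "(\<Sum>k<N. quad N F (v k)) = (\<Sum>a<N. F a a)" for F
    proof -
      have "(\<Sum>k<N. quad N F (v k)) = (\<Sum>a<N. \<Sum>b<N. F a b * (\<Sum>k<N. v k b * cnj (v k a)))"
        unfolding quad_def sum_distrib_left
        by (subst sum.swap, subst sum.swap) (simp add: mult_ac)
      also have "\<dots> = (\<Sum>a<N. \<Sum>b<N. F a b * of_bool (b = a))"
        by (intro sum.cong refl) (simp only: complete lessThan_iff)
      also have "\<dots> = (\<Sum>a<N. F a a)"
        by (intro sum.cong refl) (simp add: of_bool_def if_distrib cong: if_cong)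
      finally show ?thesis .
    qed
    have "\<bar>l k\<bar> \<le> Re (quad N P (v k)) + Re (quad N Q (v k))" if k: "k < N" for k
    proof -
      have "quad N P (v k) - quad N Q (v k) = (\<Sum>a<N. cnj (v k a) * (\<Sum>b<N. X $$ (a, b) * v k b))"
        unfolding quad_def by (simp add: X_eq sum_distrib_left algebra_simps sum_subtractf)
      also have "\<dots> = of_real (l k) * (\<Sum>a<N. cnj (v k a) * v k a)"
        using eig[OF k] by (simp add: sum_distrib_left mult_ac)
      also have "\<dots> = of_real (l k)" using orth k by simp
      finally have "l k = Re (quad N P (v k)) - Re (quad N Q (v k))" by (simp add: complex_eq_iff)
      then show ?thesis using acc unfolding accretive_def by (smt (verit))
    qed
    then have "trace_norm X \<le> (\<Sum>k<N. Re (quad N P (v k)) + Re (quad N Q (v k)))"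
      unfolding tn by (intro sum_mono) auto
    also have "\<dots> = Re (\<Sum>k<N. quad N P (v k)) + Re (\<Sum>k<N. quad N Q (v k))"
      by (simp add: sum.distrib)
    also have "\<dots> \<le> t" using le unfolding tr by (simp add: sum.distrib)
    finally show "trace_norm X \<le> t" .
  qed
qed

lemma trace_norm_nonneg: "hermitian_op N X \<Longrightarrow> 0 \<le> trace_norm X"
  using hermitian_spectral[of N X] trace_norm_spectral[of N X] by (metis abs_ge_zero sum_nonneg)

lemma split_bound_add:
  assumes "split_bound N f s" "split_bound N g t"
  shows "split_bound N (\<lambda>a b. f a b + g a b) (s + t)"
proof -
  obtain P Q where 1: "accretive N P" "accretive N Q"
    "\<forall>a<N. \<forall>b<N. f a b = P a b - Q a b" "(\<Sum>a<N. Re (P a a) + Re (Q a a)) \<le> s"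
    using assms(1) unfolding split_bound_def by blast
  obtain P' Q' where 2: "accretive N P'" "accretive N Q'"
    "\<forall>a<N. \<forall>b<N. g a b = P' a b - Q' a b" "(\<Sum>a<N. Re (P' a a) + Re (Q' a a)) \<le> t"
    using assms(2) unfolding split_bound_def by blast
  have "(\<Sum>a<N. Re (P a a + P' a a) + Re (Q a a + Q' a a)) \<le> s + t"
    using 1(4) 2(4) by (simp add: sum.distrib)
  then show ?thesis
    unfolding split_bound_def
    by (intro exI[of _ "\<lambda>a b. P a b + P' a b"] exI[of _ "\<lambda>a b. Q a b + Q' a b"])
       (use 1 2 in \<open>auto intro: accretive_add\<close>)
qed

section \<open>Depolarization of a set of qudits\<close>

lemma qdigit_less: "0 < d \<Longrightarrow> qdigit d i a < d"
  by (simp add: qdigit_def)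

lemma digit_sum_less:
  fixes d :: nat
  assumes "\<And>i. i < n \<Longrightarrow> f i < d"
  shows "(\<Sum>i<n. f i * d ^ i) < d ^ n"
  using assms
proof (induction n)
  case (Suc n)
  have "(\<Sum>i<n. f i * d ^ i) < d ^ n" using Suc by simp
  then have "(\<Sum>i<Suc n. f i * d ^ i) < d ^ n + f n * d ^ n" unfolding sum.lessThan_Suc by linarith
  also have "\<dots> = Suc (f n) * d ^ n" by simp
  also have "\<dots> \<le> d * d ^ n" using Suc.prems[of n] by (intro mult_right_mono) auto
  finally show ?case by simp
qed simp

lemma qdigit_digit_sum:
  assumes "\<And>i. i < n \<Longrightarrow> f i < d" and "i < n"
  shows "qdigit d i (\<Sum>i<n. f i * d ^ i) = f i"
  using assms
proof (induction n)
  case (Suc n)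
  define s where "s = (\<Sum>i<n. f i * d ^ i)"
  have d: "0 < d" using Suc.prems(1)[of n] by simp
  have s: "s < d ^ n" unfolding s_def using Suc.prems by (intro digit_sum_less) simp
  show ?case
  proof (cases "i = n")
    case True
    then show ?thesis
      using s d Suc.prems(1)[of n] by (simp add: qdigit_def s_def[symmetric])
  next
    case False
    then have i: "i < n" using Suc.prems by simp
    then have split: "d ^ n = d ^ (n - i) * d ^ i" by (simp flip: power_add)
    have "qdigit d i (s + f n * d ^ n) = (s + (f n * d ^ (n - i)) * d ^ i) div d ^ i mod d"
      by (simp add: qdigit_def split mult.assoc)
    also have "\<dots> = (s div d ^ i + f n * d ^ (n - i)) mod d"
      using d by (simp add: add.commute)
    also have "\<dots> = s div d ^ i mod d"
      using i by (metis dvd_mult dvd_power zero_less_diff mod_add_right_eq add.right_neutral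
          dvd_imp_mod_0)
    also have "\<dots> = f i"
      using Suc i by (simp add: s_def qdigit_def)
    finally show ?thesis by (simp add: s_def)
  qed
qed simp

lemma digit_sum_qdigit: "(\<Sum>i<n. qdigit d i a * d ^ i) = a mod d ^ n"
proof (induction n)
  case (Suc n)
  have "a mod d ^ Suc n = d ^ n * (a div d ^ n mod d) + a mod d ^ n"
    by (metis mod_mult2_eq power_Suc2)
  then show ?case using Suc by (simp add: qdigit_def)
qed simp

text \<open>Turns identities between merged indices into case distinctions on the digit
  position.\<close>

lemma qdigit_eqI:
  assumes "a < d ^ n" "b < d ^ n" and "\<And>i. i < n \<Longrightarrow> qdigit d i a = qdigit d i b"
  shows "a = b"
proof -
  have "a mod d ^ n = b mod d ^ n"
    using assms(3) by (simp flip: digit_sum_qdigit)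
  then show ?thesis using assms by simp
qed

text \<open>With \<open>0\<close> as last argument only the digits in \<open>T\<close> survive, so
  \<open>digit_merge d n T a 0\<close> serves as a label of the \<open>T\<close> part of
  \<open>a\<close>.\<close>

definition digit_merge :: "nat \<Rightarrow> nat \<Rightarrow> nat set \<Rightarrow> nat \<Rightarrow> nat \<Rightarrow> nat" where
  "digit_merge d n T c a = (\<Sum>i<n. (if i \<in> T then qdigit d i c else qdigit d i a) * d ^ i)"

lemma digit_merge_less: "0 < d \<Longrightarrow> digit_merge d n T c a < d ^ n"
  unfolding digit_merge_def by (intro digit_sum_less) (simp add: qdigit_less)

lemma qdigit_digit_merge:
  "0 < d \<Longrightarrow> i < n \<Longrightarrow>
    qdigit d i (digit_merge d n T c a) = (if i \<in> T then qdigit d i c else qdigit d i a)"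
  unfolding digit_merge_def by (subst qdigit_digit_sum) (simp_all add: qdigit_less)

text \<open>Makes the exchange of the \<open>T\<close> digits of two indices an involution of pairs,
  ready for reindexing sums.\<close>

lemma digit_merge_digit_merge:
  assumes "0 < d" "a < d ^ n"
  shows "digit_merge d n T (digit_merge d n T a x) (digit_merge d n T y a) = a"
  by (rule qdigit_eqI[of _ d n]) (simp_all add: assms digit_merge_less qdigit_digit_merge)

text \<open>No carry occurs because digit \<open>i\<close> of \<open>a\<close> is zero. This links
  digits to \<open>ptrace_zero\<close>, whose summation indices have the form
  \<open>a + j * d ^ i\<close>.\<close>

lemma qdigit_add_shift:
  assumes "a < d ^ n" "i < n" "j < d" "qdigit d i a = 0"
  shows "a + j * d ^ i < d ^ n"
    and "i' < n \<Longrightarrow> qdigit d i' (a + j * d ^ i) = (if i' = i then j else qdigit d i' a)"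
proof -
  define f where "f i' = (if i' = i then j else qdigit d i' a)" for i'
  have f: "f i' < d" for i' using \<open>j < d\<close> by (simp add: f_def qdigit_less)
  have "a = (\<Sum>i<n. qdigit d i a * d ^ i)" using \<open>a < d ^ n\<close> by (simp add: digit_sum_qdigit)
  also have "\<dots> = (\<Sum>i'\<in>{..<n} - {i}. f i' * d ^ i')"
    using assms by (subst sum.remove[of _ i]) (auto simp: f_def intro!: sum.cong)
  also have "\<dots> + j * d ^ i = (\<Sum>i'<n. f i' * d ^ i')"
    using assms by (subst (2) sum.remove[of _ i]) (auto simp: f_def)
  finally have eq: "a + j * d ^ i = (\<Sum>i'<n. f i' * d ^ i')" by simp
  show "a + j * d ^ i < d ^ n" unfolding eq using f by (intro digit_sum_less)
  show "i' < n \<Longrightarrow> qdigit d i' (a + j * d ^ i) = (if i' = i then j else qdigit d i' a)"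
    unfolding eq using f by (subst qdigit_digit_sum) (auto simp: f_def)
qed

text \<open>Exchanging \<open>T\<close> digits permutes the pairs \<open>(a, c)\<close>. Afterwards
  the summand depends on one coordinate only, and the free one contributes the factor
  \<open>d ^ n\<close>.\<close>

lemma sum_digit_merge_swap:
  assumes "0 < d"
  shows "(\<Sum>a<d ^ n. \<Sum>c<d ^ n. F (digit_merge d n T c a)) =
    of_nat (d ^ n) * (\<Sum>x<d ^ n. F x :: complex)"
proof -
  let ?M = "\<lambda>(a, c). (digit_merge d n T a c, digit_merge d n T c a)"
  have "(\<Sum>(a, c)\<in>{..<d ^ n} \<times> {..<d ^ n}. F (digit_merge d n T c a)) =
      (\<Sum>(y, x)\<in>{..<d ^ n} \<times> {..<d ^ n}. F x)"
    by (rule sum.reindex_bij_witness[where i = ?M and j = ?M])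
       (auto simp: digit_merge_less digit_merge_digit_merge assms)
  then show ?thesis
    by (simp flip: sum.cartesian_product)
qed

text \<open>\<open>depol d n T\<close> completely depolarizes the qudits in \<open>T\<close>. Summing over all \<open>c < d ^ n\<close>
  counts every setting of the digits in \<open>T\<close> equally often, so the weight is \<open>1 / d ^ n\<close>
  whatever the size of \<open>T\<close>.\<close>

definition depol :: "nat \<Rightarrow> nat \<Rightarrow> nat set \<Rightarrow> (nat \<Rightarrow> nat \<Rightarrow> complex) \<Rightarrow> nat \<Rightarrow> nat \<Rightarrow> complex" where
  "depol d n T f a b =
    (if digit_merge d n T a 0 = digit_merge d n T b 0
     then (\<Sum>c<d ^ n. f (digit_merge d n T c a) (digit_merge d n T c b)) / of_nat (d ^ n) else 0)"

lemma digit_merge_0_eq_iff: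
  assumes "0 < d"
  shows "digit_merge d n T a 0 = digit_merge d n T b 0 \<longleftrightarrow>
    (\<forall>i<n. i \<in> T \<longrightarrow> qdigit d i a = qdigit d i b)"
proof
  assume "digit_merge d n T a 0 = digit_merge d n T b 0"
  then show "\<forall>i<n. i \<in> T \<longrightarrow> qdigit d i a = qdigit d i b"
    using qdigit_digit_merge[OF assms] by metis
next
  assume "\<forall>i<n. i \<in> T \<longrightarrow> qdigit d i a = qdigit d i b"
  then show "digit_merge d n T a 0 = digit_merge d n T b 0"
    unfolding digit_merge_def by (auto intro!: sum.cong)
qed

lemma depol_empty:
  assumes "0 < d" "a < d ^ n" "b < d ^ n"
  shows "depol d n {} f a b = f a b"
proof -
  have "digit_merge d n {} c x = x" if "x < d ^ n" for c x
    using that by (simp add: digit_merge_def digit_sum_qdigit)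
  then show ?thesis using assms by (simp add: depol_def digit_merge_0_eq_iff)
qed

text \<open>Depolarizing every qudit leaves a multiple of the identity, with the trace divided by
  \<open>d ^ n\<close> as coefficient.\<close>

lemma depol_all:
  assumes "0 < d" "(\<Sum>c<d ^ n. f c c) = 0"
  shows "depol d n {..<n} f a b = 0"
proof -
  have "digit_merge d n {..<n} c x = c" if "c < d ^ n" for c x
    using that by (simp add: digit_merge_def digit_sum_qdigit)
  then show ?thesis using assms(2) by (simp add: depol_def)
qed

lemma depol_diff:
  assumes "0 < d" and "\<And>a b. a < d ^ n \<Longrightarrow> b < d ^ n \<Longrightarrow> f a b = g a b - h a b"
  shows "depol d n T f a b = depol d n T g a b - depol d n T h a b"
  using assms by (simp add: depol_def digit_merge_less sum_subtractf diff_divide_distrib)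

lemma cnj_depol:
  assumes "0 < d" and "\<And>a b. a < d ^ n \<Longrightarrow> b < d ^ n \<Longrightarrow> cnj (f b a) = f a b"
  shows "cnj (depol d n T f b a) = depol d n T f a b"
  using assms by (auto simp: depol_def digit_merge_less)

lemma sum_depol_diag:
  assumes "0 < d"
  shows "(\<Sum>a<d ^ n. depol d n T f a a) = (\<Sum>a<d ^ n. f a a)"
proof -
  have "(\<Sum>a<d ^ n. depol d n T f a a) =
      (\<Sum>a<d ^ n. \<Sum>c<d ^ n. f (digit_merge d n T c a) (digit_merge d n T c a)) / of_nat (d ^ n)"
    by (simp add: depol_def sum_divide_distrib)
  also have "\<dots> = (\<Sum>a<d ^ n. f a a)"
    using assms sum_digit_merge_swap[OF assms, where F = "\<lambda>x. f x x"] by simp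
  finally show ?thesis .
qed

text \<open>Pulling \<open>f\<close> back along \<open>g\<close> amounts to evaluating its form at
  the vector that sums \<open>u\<close> over the fibres of \<open>g\<close>. Relabelling indices
  therefore preserves accretivity.\<close>

lemma quad_pushforward:
  assumes "finite A" "g ` A \<subseteq> {..<N}"
  shows "quad N f (\<lambda>x. \<Sum>a\<in>{a \<in> A. g a = x}. u a) =
    (\<Sum>a\<in>A. \<Sum>b\<in>A. cnj (u a) * f (g a) (g b) * u b)"
proof -
  have inner: "(\<Sum>y<N. h y * (\<Sum>a\<in>{a \<in> A. g a = y}. w a)) = (\<Sum>a\<in>A. h (g a) * w a)"
    for h w :: "_ \<Rightarrow> complex"
  proof -
    have "(\<Sum>y<N. h y * (\<Sum>a\<in>{a \<in> A. g a = y}. w a)) =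
        (\<Sum>y<N. \<Sum>a\<in>{a \<in> A. g a = y}. h (g a) * w a)"
      by (simp add: sum_distrib_left)
    also have "\<dots> = (\<Sum>a\<in>A. h (g a) * w a)"
      using assms by (intro sum.group) auto
    finally show ?thesis .
  qed
  define w where "w x = (\<Sum>a\<in>{a \<in> A. g a = x}. u a)" for x
  have "quad N f w = (\<Sum>x<N. (\<Sum>y<N. f x y * w y) * cnj (w x))"
    by (simp add: quad_def sum_distrib_left sum_distrib_right mult_ac)
  also have "\<dots> = (\<Sum>a\<in>A. (\<Sum>b\<in>A. f (g a) (g b) * u b) * cnj (u a))"
    unfolding w_def cnj_sum inner ..
  also have "\<dots> = (\<Sum>a\<in>A. \<Sum>b\<in>A. cnj (u a) * f (g a) (g b) * u b)"
    by (simp add: sum_distrib_left sum_distrib_right mult_ac)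
  finally show ?thesis unfolding w_def .
qed

text \<open>Depolarization is a positive map: its form splits into blocks of indices with equal
  \<open>T\<close> digits, and on each block it averages over \<open>c\<close> the pullbacks of
  \<open>f\<close> along \<open>m c\<close>.\<close>

lemma accretive_depol:
  assumes "0 < d" and f: "accretive (d ^ n) f"
  shows "accretive (d ^ n) (depol d n T f)"
  unfolding accretive_def
proof
  fix v
  define N where "N = d ^ n"
  define m where "m = digit_merge d n T"
  define A where "A e = {a. a < N \<and> m a 0 = e}" for e
  have m: "m c a < N" for c a using assms by (simp add: m_def N_def digit_merge_less)
  have AA: "A e = {a \<in> {..<N}. m a 0 = e}" for e by (auto simp: A_def)
  \<comment> \<open>The labels \<open>e\<close> run through all of \<open>{..<N}\<close>; a value
    that labels no index gives an empty block.\<close>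
  have grp: "(\<Sum>a<N. \<Sum>b<N. if m a 0 = m b 0 then G a b else 0) =
      (\<Sum>e<N. \<Sum>a\<in>A e. \<Sum>b\<in>A e. G a b)" for G :: "nat \<Rightarrow> nat \<Rightarrow> complex"
  proof -
    have "(\<Sum>e<N. \<Sum>a\<in>A e. \<Sum>b\<in>A e. G a b) = (\<Sum>e<N. \<Sum>a\<in>A e. \<Sum>b\<in>A (m a 0). G a b)"
      by (intro sum.cong refl) (auto simp: A_def)
    also have "\<dots> = (\<Sum>a<N. \<Sum>b\<in>A (m a 0). G a b)"
      unfolding AA by (rule sum.group) (auto simp: m)
    also have "\<dots> = (\<Sum>a<N. \<Sum>b<N. if m b 0 = m a 0 then G a b else 0)"
      unfolding AA by (intro sum.cong refl sum.inter_filter) auto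
    also have "\<dots> = (\<Sum>a<N. \<Sum>b<N. if m a 0 = m b 0 then G a b else 0)"
      by (intro sum.cong refl) auto
    finally show ?thesis ..
  qed
  have "quad N (depol d n T f) v = (\<Sum>a<N. \<Sum>b<N. if m a 0 = m b 0
      then (\<Sum>c<N. cnj (v a) * f (m c a) (m c b) * v b) / of_nat N else 0)"
    unfolding quad_def depol_def m_def[symmetric] N_def[symmetric]
    by (intro sum.cong refl) (simp add: sum_distrib_left sum_distrib_right)
  also have "\<dots> = (\<Sum>e<N. \<Sum>a\<in>A e. \<Sum>b\<in>A e. (\<Sum>c<N. cnj (v a) * f (m c a) (m c b) * v b) / of_nat N)"
    by (rule grp)
  also have "\<dots> = (\<Sum>e<N. \<Sum>c<N. \<Sum>a\<in>A e. \<Sum>b\<in>A e. cnj (v a) * f (m c a) (m c b) * v b) / of_nat N"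
  proof -
    have "(\<Sum>a\<in>B. \<Sum>b\<in>B. \<Sum>c<N. G a b c) = (\<Sum>c<N. \<Sum>a\<in>B. \<Sum>b\<in>B. G a b c)"
      for B and G :: "nat \<Rightarrow> nat \<Rightarrow> nat \<Rightarrow> complex"
    proof -
      have "(\<Sum>a\<in>B. \<Sum>b\<in>B. \<Sum>c<N. G a b c) = (\<Sum>a\<in>B. \<Sum>c<N. \<Sum>b\<in>B. G a b c)"
        by (intro sum.cong refl sum.swap)
      also have "\<dots> = (\<Sum>c<N. \<Sum>a\<in>B. \<Sum>b\<in>B. G a b c)" by (rule sum.swap)
      finally show ?thesis .
    qed
    then show ?thesis by (simp only: flip: sum_divide_distrib)
  qed
  also have "\<dots> = (\<Sum>e<N. \<Sum>c<N. quad N f (\<lambda>x. \<Sum>a\<in>{a \<in> A e. m c a = x}. v a)) / of_nat N"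
    by (subst quad_pushforward) (auto simp: m AA)
  finally have "Re (quad N (depol d n T f) v) =
      (\<Sum>e<N. \<Sum>c<N. Re (quad N f (\<lambda>x. \<Sum>a\<in>{a \<in> A e. m c a = x}. v a))) / real N"
    by (simp add: Re_divide_of_nat)
  also have "\<dots> \<ge> 0"
    using f by (intro divide_nonneg_nonneg sum_nonneg) (auto simp: accretive_def N_def)
  finally show "0 \<le> Re (quad (d ^ n) (depol d n T f) v)" by (simp add: N_def)
qed

text \<open>Positivity and trace preservation carry a decomposition of \<open>f\<close> to one of
  equal cost, so depolarization contracts the trace norm.\<close>

lemma split_bound_depol:
  assumes "0 < d" and "split_bound (d ^ n) f t"
  shows "split_bound (d ^ n) (depol d n T f) t"
proof -
  obtain P Q where PQ: "accretive (d ^ n) P" "accretive (d ^ n) Q"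
    and f: "\<And>a b. a < d ^ n \<Longrightarrow> b < d ^ n \<Longrightarrow> f a b = P a b - Q a b"
    and t: "(\<Sum>a<d ^ n. Re (P a a) + Re (Q a a)) \<le> t"
    using assms(2) unfolding split_bound_def by blast
  have "(\<Sum>a<d ^ n. Re (depol d n T F a a)) = (\<Sum>a<d ^ n. Re (F a a))" for F
    using sum_depol_diag[OF assms(1), of n T F] by (simp flip: Re_sum)
  then have "(\<Sum>a<d ^ n. Re (depol d n T P a a) + Re (depol d n T Q a a)) \<le> t"
    using t by (simp add: sum.distrib)
  then show ?thesis
    unfolding split_bound_def using PQ depol_diff[OF assms(1) f]
    by (intro exI[of _ "depol d n T P"] exI[of _ "depol d n T Q"])
       (auto intro!: accretive_depol assms(1))
qed

lemma split_bound_uminus: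
  assumes "split_bound N f t"
  shows "split_bound N (\<lambda>a b. - f a b) t"
proof -
  obtain P Q where "accretive N P" "accretive N Q"
    "\<forall>a<N. \<forall>b<N. f a b = P a b - Q a b" "(\<Sum>a<N. Re (P a a) + Re (Q a a)) \<le> t"
    using assms unfolding split_bound_def by blast
  then show ?thesis
    unfolding split_bound_def by (intro exI[of _ Q] exI[of _ P]) (auto simp: add.commute)
qed

text \<open>Depolarizing qudit \<open>i\<close> does not change the partial trace over
  \<open>i\<close>. This is what makes the telescoping differences feasible.\<close>

lemma sum_depol_insert:
  assumes "0 < d" "i < n" "i \<notin> T" and a: "a < d ^ n" "qdigit d i a = 0"
    and b: "b < d ^ n" "qdigit d i b = 0"
  shows "(\<Sum>j<d. depol d n T f (a + j * d ^ i) (b + j * d ^ i)) =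
    (\<Sum>j<d. depol d n (insert i T) f (a + j * d ^ i) (b + j * d ^ i))"
proof (cases "\<forall>i<n. i \<in> T \<longrightarrow> qdigit d i a = qdigit d i b")
  \<comment> \<open>A position in \<open>T\<close> where \<open>a\<close> and \<open>b\<close>
    differ is untouched by shifting digit \<open>i\<close>, so all terms on both sides
    vanish.\<close>
  case False
  then obtain i' where i': "i' < n" "i' \<in> T" "i' \<noteq> i" "qdigit d i' a \<noteq> qdigit d i' b"
    using \<open>i \<notin> T\<close> by blast
  have "depol d n U f (a + j * d ^ i) (b + j * d ^ i) = 0" if "i' \<in> U" "j < d" for U j
  proof -
    have "qdigit d i' (a + j * d ^ i) \<noteq> qdigit d i' (b + j * d ^ i)"
      using i' that qdigit_add_shift(2)[OF a(1) \<open>i < n\<close> _ a(2)]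
        qdigit_add_shift(2)[OF b(1) \<open>i < n\<close> _ b(2)] by simp
    then have "digit_merge d n U (a + j * d ^ i) 0 \<noteq> digit_merge d n U (b + j * d ^ i) 0"
      using i'(1) that digit_merge_0_eq_iff[OF \<open>0 < d\<close>] by blast
    then show ?thesis by (simp add: depol_def)
  qed
  then show ?thesis using i' by simp
next
  case True
  note [simp] = qdigit_digit_merge[OF \<open>0 < d\<close>] digit_merge_less[OF \<open>0 < d\<close>]
  \<comment> \<open>\<open>upd j c\<close> overwrites digit \<open>i\<close> of \<open>c\<close> by
    \<open>j\<close>. Depolarizing only \<open>T\<close> keeps digit \<open>i\<close> of the
    argument, which is \<open>j\<close>, so its summand at \<open>c\<close> is the summand for
    \<open>insert i T\<close> at \<open>upd j c\<close>.\<close>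
  define upd where "upd j c = digit_merge d n {i} (j * d ^ i) c" for j c
  define g where "g c = f (digit_merge d n (insert i T) c a) (digit_merge d n (insert i T) c b)" for c
  have "qdigit d i 0 = 0" "0 < d ^ n" using \<open>0 < d\<close> by (auto simp: qdigit_def)
  then have "qdigit d i (0 + j * d ^ i) = j" if "j < d" for j
    using qdigit_add_shift(2)[of 0 d n i j i] \<open>i < n\<close> that by simp
  then have upd: "qdigit d i' (upd j c) = (if i' = i then j else qdigit d i' c)"
    if "j < d" "i' < n" for j c i'
    using that by (simp add: upd_def)
  have upd_less: "upd j c < d ^ n" for j c by (simp add: upd_def)
  have upd_upd: "upd (qdigit d i c) (upd j c) = c" if "c < d ^ n" "j < d" for j c
    by (rule qdigit_eqI[of _ d n])
       (use that \<open>0 < d\<close> in \<open>simp_all add: upd upd_less qdigit_less\<close>)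
  have 1: "digit_merge d n T c (x + j * d ^ i) = digit_merge d n (insert i T) (upd j c) x"
    if "j < d" "x < d ^ n" "qdigit d i x = 0" for j c x
    by (rule qdigit_eqI[of _ d n])
       (use \<open>i \<notin> T\<close> in \<open>simp_all add: upd that qdigit_add_shift(2)[OF that(2) \<open>i < n\<close> that(1,3)]\<close>)
  have 2: "digit_merge d n (insert i T) c (x + j * d ^ i) = digit_merge d n (insert i T) c x"
    if "j < d" "x < d ^ n" "qdigit d i x = 0" for j c x
    by (rule qdigit_eqI[of _ d n])
       (simp_all add: qdigit_add_shift(2)[OF that(2) \<open>i < n\<close> that(1,3)])
  have "(\<Sum>j<d. depol d n T f (a + j * d ^ i) (b + j * d ^ i)) =
      (\<Sum>j<d. \<Sum>c<d ^ n. g (upd j c)) / of_nat (d ^ n)"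
    unfolding sum_divide_distrib
  proof (intro sum.cong refl)
    fix j assume j: "j \<in> {..<d}"
    have "digit_merge d n T (a + j * d ^ i) 0 = digit_merge d n T (b + j * d ^ i) 0"
      using True j qdigit_add_shift(2)[OF a(1) \<open>i < n\<close> _ a(2)] qdigit_add_shift(2)[OF b(1) \<open>i < n\<close> _ b(2)]
      by (simp add: digit_merge_0_eq_iff \<open>0 < d\<close>)
    then show "depol d n T f (a + j * d ^ i) (b + j * d ^ i) = (\<Sum>c<d ^ n. g (upd j c) / of_nat (d ^ n))"
      using j 1 a b by (simp add: depol_def g_def sum_divide_distrib)
  qed
  \<comment> \<open>The reindexing swaps \<open>j\<close> with digit \<open>i\<close> of
    \<open>c\<close> and is its own inverse.\<close>
  also have "(\<Sum>j<d. \<Sum>c<d ^ n. g (upd j c)) = (\<Sum>j<d. \<Sum>c<d ^ n. g c)"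
    unfolding sum.cartesian_product
    by (rule sum.reindex_bij_witness[where i = "\<lambda>(j, c). (qdigit d i c, upd j c)"
          and j = "\<lambda>(j, c). (qdigit d i c, upd j c)"])
       (use \<open>i < n\<close> \<open>0 < d\<close> in \<open>auto simp: upd upd_less upd_upd qdigit_less\<close>)
  also have "\<dots> / of_nat (d ^ n) =
      (\<Sum>j<d. depol d n (insert i T) f (a + j * d ^ i) (b + j * d ^ i))"
    unfolding sum_divide_distrib
  proof (intro sum.cong refl)
    fix j assume j: "j \<in> {..<d}"
    have "digit_merge d n (insert i T) (a + j * d ^ i) 0 = digit_merge d n (insert i T) (b + j * d ^ i) 0"
      using True j qdigit_add_shift(2)[OF a(1) \<open>i < n\<close> _ a(2)] qdigit_add_shift(2)[OF b(1) \<open>i < n\<close> _ b(2)]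
      by (simp add: digit_merge_0_eq_iff \<open>0 < d\<close>)
    then show "(\<Sum>c<d ^ n. g c / of_nat (d ^ n)) = depol d n (insert i T) f (a + j * d ^ i) (b + j * d ^ i)"
      using j 2 a b by (simp add: depol_def g_def sum_divide_distrib)
  qed
  finally show ?thesis .
qed

text \<open>The merged index determines the \<open>T\<close> digits of \<open>e\<close>; the
  remaining digits of \<open>e\<close> are free, and \<open>K\<close> counts their settings.\<close>

lemma sum_digit_merge_fiber:
  fixes F :: "nat \<Rightarrow> complex" and T :: "nat set" and d n :: nat
  assumes "0 < d"
  defines "K \<equiv> {c. c < d ^ n \<and> (\<forall>i<n. i \<in> T \<longrightarrow> qdigit d i c = 0)}"
  shows "(\<Sum>e<d ^ n. F (digit_merge d n T e a)) =
    of_nat (card K) * (\<Sum>z | z < d ^ n \<and> (\<forall>i<n. i \<notin> T \<longrightarrow> qdigit d i z = qdigit d i a). F z)"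
    and "card K \<noteq> 0"
proof -
  note [simp] = qdigit_digit_merge[OF \<open>0 < d\<close>] digit_merge_less[OF \<open>0 < d\<close>]
  let ?Z = "{z. z < d ^ n \<and> (\<forall>i<n. i \<notin> T \<longrightarrow> qdigit d i z = qdigit d i a)}"
  have 1: "digit_merge d n T 0 (digit_merge d n T z c) = c" if "c \<in> K" for z c
    by (rule qdigit_eqI[of _ d n]) (use that in \<open>simp_all add: K_def qdigit_def[of _ _ 0]\<close>)
  have 2: "digit_merge d n T (digit_merge d n T z c) a = z" if "z \<in> ?Z" for z c
    by (rule qdigit_eqI[of _ d n]) (use that in simp_all)
  have 3: "digit_merge d n T 0 e \<in> K" "digit_merge d n T e a \<in> ?Z" for e
    by (simp_all add: K_def qdigit_def[of _ _ 0])
  have "(\<Sum>e<d ^ n. F (digit_merge d n T e a)) = (\<Sum>(c, z)\<in>K \<times> ?Z. F z)"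
    by (rule sum.reindex_bij_witness[where i = "\<lambda>(c, z). digit_merge d n T z c"
          and j = "\<lambda>e. (digit_merge d n T 0 e, digit_merge d n T e a)"])
       (use 1 2 3 in \<open>auto simp: digit_merge_digit_merge \<open>0 < d\<close>\<close>)
  then show "(\<Sum>e<d ^ n. F (digit_merge d n T e a)) = of_nat (card K) * (\<Sum>z\<in>?Z. F z)"
    by (simp flip: sum.cartesian_product)
  have "0 \<in> K" "finite K" using assms(1) by (auto simp: K_def qdigit_def)
  then show "card K \<noteq> 0" by auto
qed

text \<open>This is cyclicity of the partial trace over \<open>S\<close> for an operator acting as
  the identity outside \<open>S\<close>. The two sides are the sums that depolarize
  \<open>H |p><p|\<close> and \<open>|p><p| H\<close>, so the commutator depolarizes to
  zero.\<close>

lemma depol_commutator: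
  fixes p :: "nat \<Rightarrow> complex"
  assumes "0 < d" "S \<subseteq> {..<n}" and H: "hermitian_op (d ^ n) H" "acts_only_on d n S H"
    and a: "a < d ^ n" and b: "b < d ^ n"
  defines "h \<equiv> \<lambda>x. \<Sum>z<d ^ n. H $$ (x, z) * p z"
  shows "(\<Sum>c<d ^ n. h (digit_merge d n S c a) * cnj (p (digit_merge d n S c b))) =
    (\<Sum>c<d ^ n. p (digit_merge d n S c a) * cnj (h (digit_merge d n S c b)))"
proof -
  note [simp] = qdigit_digit_merge[OF \<open>0 < d\<close>] digit_merge_less[OF \<open>0 < d\<close>]
  define N where "N = d ^ n"
  define m where "m = digit_merge d n S"
  have mN: "m c x < N" for c x by (simp add: m_def N_def)
  define k :: complex where "k = of_nat (card {c. c < d ^ n \<and> (\<forall>i<n. i \<in> S \<longrightarrow> qdigit d i c = 0)})"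
  have k: "k \<noteq> 0" using sum_digit_merge_fiber(2)[OF \<open>0 < d\<close>] by (simp add: k_def)
  \<comment> \<open>Only indices \<open>z\<close> agreeing with \<open>x\<close> outside
    \<open>S\<close> contribute. Summing over \<open>e\<close> instead counts each of them
    \<open>k\<close> times and gives both variables of the double sum the same range.\<close>
  have h: "k * h (m c x) = (\<Sum>e<N. H $$ (m c x, m e x) * p (m e x))" for c x
  proof -
    have "h (m c x) = (\<Sum>z | z < N \<and> (\<forall>i<n. i \<notin> S \<longrightarrow> qdigit d i z = qdigit d i x). H $$ (m c x, z) * p z)"
      unfolding h_def N_def[symmetric]
    proof (rule sum.mono_neutral_right)
      show "\<forall>z\<in>{..<N} - {z. z < N \<and> (\<forall>i<n. i \<notin> S \<longrightarrow> qdigit d i z = qdigit d i x)}.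
          H $$ (m c x, z) * p z = 0"
      proof
        fix z assume "z \<in> {..<N} - {z. z < N \<and> (\<forall>i<n. i \<notin> S \<longrightarrow> qdigit d i z = qdigit d i x)}"
        then obtain i where "z < d ^ n" "i < n" "i \<notin> S" "qdigit d i (m c x) \<noteq> qdigit d i z"
          by (auto simp: N_def m_def)
        then have "H $$ (m c x, z) = 0"
          using H(2) mN unfolding acts_only_on_def N_def by blast
        then show "H $$ (m c x, z) * p z = 0" by simp
      qed
    qed auto
    then show ?thesis
      using sum_digit_merge_fiber(1)[OF \<open>0 < d\<close>, of "\<lambda>z. H $$ (m c x, z) * p z" n S x]
      by (simp add: k_def m_def N_def)
  qed
  have ck: "cnj k = k" by (simp add: k_def)
  have "k * (\<Sum>c<N. h (m c a) * cnj (p (m c b))) =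
      (\<Sum>c<N. \<Sum>e<N. H $$ (m c a, m e a) * p (m e a) * cnj (p (m c b)))"
    using h[of _ a] by (simp add: sum_distrib_left sum_distrib_right flip: mult.assoc)
  also have "\<dots> = (\<Sum>c<N. \<Sum>e<N. cnj (H $$ (m e b, m c b)) * p (m e a) * cnj (p (m c b)))"
  proof (intro sum.cong refl)
    fix c e
    \<comment> \<open>The entry depends only on the \<open>S\<close> digits, which come from
      \<open>c\<close> and \<open>e\<close>, so \<open>a\<close> may be replaced by
      \<open>b\<close>. Hermiticity then moves \<open>H\<close> to the conjugated factor.\<close>
    have "H $$ (m c a, m e a) = H $$ (m c b, m e b)"
    proof -
      have "\<forall>i<n. i \<notin> S \<longrightarrow> qdigit d i (m c a) = qdigit d i (m e a) \<and> qdigit d i (m c b) = qdigit d i (m e b)"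
        by (simp add: m_def)
      moreover have "\<forall>i\<in>S. qdigit d i (m c a) = qdigit d i (m c b) \<and> qdigit d i (m e a) = qdigit d i (m e b)"
        using \<open>S \<subseteq> {..<n}\<close> by (auto simp: m_def)
      ultimately show ?thesis
        using H(2)[unfolded acts_only_on_def, THEN conjunct2, rule_format,
            of "m c a" "m e a" "m c b" "m e b"] mN unfolding N_def by blast
    qed
    then show "H $$ (m c a, m e a) * p (m e a) * cnj (p (m c b)) =
        cnj (H $$ (m e b, m c b)) * p (m e a) * cnj (p (m c b))"
      using hermitian_op_cnj[OF H(1), of "m e b" "m c b"] mN by (simp add: N_def)
  qed
  also have "\<dots> = (\<Sum>e<N. p (m e a) * cnj (\<Sum>c<N. H $$ (m e b, m c b) * p (m c b)))"
    by (subst sum.swap) (simp add: sum_distrib_left mult_ac)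
  also have "\<dots> = k * (\<Sum>c<N. p (m c a) * cnj (h (m c b)))"
    unfolding h[symmetric] using ck by (simp add: sum_distrib_left mult_ac)
  finally show ?thesis using k by (simp add: m_def N_def)
qed

section \<open>Time evolution of a pure state\<close>

lemma pow_mat_carrier:
  "A \<in> carrier_mat N N \<Longrightarrow> A ^\<^sub>m m \<in> carrier_mat N N"
  by (induction m) auto

text \<open>\<open>^\<^sub>m\<close> multiplies on the right, while the evolution equation has the
  generator on the left.\<close>

lemma pow_mat_Suc_left:
  assumes A: "A \<in> carrier_mat N N"
  shows "A ^\<^sub>m Suc m = A * A ^\<^sub>m m"
proof (induction m)
  case 0
  then show ?case using A by simp
next
  case (Suc m)
  have "A ^\<^sub>m Suc (Suc m) = (A * A ^\<^sub>m m) * A" using Suc by simp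
  also have "\<dots> = A * A ^\<^sub>m Suc m" 
    using assoc_mult_mat[OF A pow_mat_carrier[OF A] A] by simp
  finally show ?case .
qed

lemma pow_mat_smult_nth:
  fixes A :: "complex mat"
  assumes A: "A \<in> carrier_mat N N" and "i < N" "j < N"
  shows "((c \<cdot>\<^sub>m A) ^\<^sub>m m) $$ (i, j) = c ^ m * (A ^\<^sub>m m) $$ (i, j)"
  using assms(3)
proof (induction m arbitrary: j)
  case (Suc m)
  have "((c \<cdot>\<^sub>m A) ^\<^sub>m Suc m) $$ (i, j) = (\<Sum>k<N. ((c \<cdot>\<^sub>m A) ^\<^sub>m m) $$ (i, k) * (c \<cdot>\<^sub>m A) $$ (k, j))"
    unfolding pow_mat.simps using Suc.prems assms(2) A
    by (intro mult_mat_nth) (auto intro!: pow_mat_carrier)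
  also have "\<dots> = (\<Sum>k<N. c ^ Suc m * ((A ^\<^sub>m m) $$ (i, k) * A $$ (k, j)))"
    using Suc A by (intro sum.cong refl) simp
  also have "\<dots> = c ^ Suc m * (A ^\<^sub>m Suc m) $$ (i, j)"
    unfolding pow_mat.simps using mult_mat_nth[OF pow_mat_carrier[OF A] A assms(2) Suc.prems]
    by (simp add: sum_distrib_left)
  finally show ?case .
qed (use A assms in auto)

lemma norm_pow_mat_le:
  fixes A :: "complex mat"
  assumes A: "A \<in> carrier_mat N N" and "i < N" "j < N"
  shows "cmod ((A ^\<^sub>m m) $$ (i, j)) \<le> (\<Sum>a<N. \<Sum>b<N. cmod (A $$ (a, b))) ^ m"
  using assms(3)
proof (induction m arbitrary: j)
  case (Suc m)
  define C where "C = (\<Sum>a<N. \<Sum>b<N. cmod (A $$ (a, b)))"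
  have C: "0 \<le> C" unfolding C_def by (intro sum_nonneg) simp
  have "cmod ((A ^\<^sub>m Suc m) $$ (i, j)) = cmod (\<Sum>k<N. (A ^\<^sub>m m) $$ (i, k) * A $$ (k, j))"
    unfolding pow_mat.simps using mult_mat_nth[OF pow_mat_carrier[OF A] A assms(2) Suc.prems] by simp
  also have "\<dots> \<le> (\<Sum>k<N. C ^ m * cmod (A $$ (k, j)))"
    using Suc.IH unfolding C_def[symmetric]
    by (intro sum_norm_le) (simp add: norm_mult mult_right_mono)
  also have "\<dots> \<le> (\<Sum>k<N. C ^ m * (\<Sum>b<N. cmod (A $$ (k, b))))"
    using Suc.prems C by (intro sum_mono mult_left_mono member_le_sum) auto
  also have "\<dots> = C ^ Suc m" 
    unfolding sum_distrib_left[symmetric] C_def[symmetric] by simp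
  finally show ?case by (simp add: C_def)
qed (use A assms in auto)

text \<open>An entry of \<open>exp (z A)\<close> as a power series in a complex variable, so that
  termwise differentiation applies; time evolution is the restriction to
  \<open>z = - \<i> * t\<close>.\<close>

definition exp_entry :: "complex mat \<Rightarrow> nat \<Rightarrow> nat \<Rightarrow> complex \<Rightarrow> complex" where
  "exp_entry A i j z = (\<Sum>m. (A ^\<^sub>m m) $$ (i, j) / of_nat (fact m) * z ^ m)"

lemma summable_exp_entry:
  fixes A :: "complex mat"
  assumes A: "A \<in> carrier_mat N N" and "i < N" "j < N"
  shows "summable (\<lambda>m. (A ^\<^sub>m m) $$ (i, j) / of_nat (fact m) * z ^ m)"
proof (rule summable_comparison_test')
  define C where "C = (\<Sum>a<N. \<Sum>b<N. cmod (A $$ (a, b)))"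
  show "summable (\<lambda>m. inverse (fact m) * (C * cmod z) ^ m)" by (rule summable_exp)
  show "norm ((A ^\<^sub>m m) $$ (i, j) / of_nat (fact m) * z ^ m) \<le> inverse (fact m) * (C * cmod z) ^ m"
    if "m \<ge> 0" for m
    using mult_right_mono[OF norm_pow_mat_le[OF assms, of m], of "cmod z ^ m / fact m"]
    by (simp add: C_def norm_mult norm_divide norm_power power_mult_distrib field_simps)
qed

lemma exp_entry_0:
  assumes "A \<in> carrier_mat N N" and "i < N" "j < N"
  shows "exp_entry A i j 0 = of_bool (i = j)"
proof -
  have "exp_entry A i j 0 = (A ^\<^sub>m 0) $$ (i, j) / of_nat (fact 0)"
    unfolding exp_entry_def by (rule powser_zero)
  then show ?thesis using assms by simp
qed

lemma DERIV_exp_entry: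
  assumes A: "A \<in> carrier_mat N N" and ij: "i < N" "j < N"
  shows "(exp_entry A i j has_field_derivative (\<Sum>k<N. A $$ (i, k) * exp_entry A k j z)) (at z)"
proof -
  define c where "c k m = (A ^\<^sub>m m) $$ (k, j) / of_nat (fact m)" for k m
  have "((\<lambda>z. \<Sum>m. c i m * z ^ m) has_field_derivative (\<Sum>m. diffs (c i) m * z ^ m)) (at z)"
    unfolding c_def by (intro termdiffs_strong_converges_everywhere summable_exp_entry[OF A ij])
  moreover have "diffs (c i) m = (\<Sum>k<N. A $$ (i, k) * c k m)" for m
  proof -
    have "of_nat (fact (Suc m)) = (of_nat (Suc m) * of_nat (fact m) :: complex)"
      unfolding of_nat_mult[symmetric] by (simp only: fact_Suc of_nat_id)
    then have "diffs (c i) m = (A ^\<^sub>m Suc m) $$ (i, j) / of_nat (fact m)"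
      unfolding diffs_def c_def times_divide_eq_right
      by (simp only: mult_divide_mult_cancel_left_if of_nat_eq_0_iff nat.simps if_False)
    also have "(A ^\<^sub>m Suc m) $$ (i, j) = (\<Sum>k<N. A $$ (i, k) * (A ^\<^sub>m m) $$ (k, j))"
      unfolding pow_mat_Suc_left[OF A] by (rule mult_mat_nth[OF A pow_mat_carrier[OF A] ij])
    finally show ?thesis by (simp add: c_def[of _ m] sum_divide_distrib)
  qed
  moreover have "(\<Sum>m. (\<Sum>k<N. A $$ (i, k) * c k m) * z ^ m) =
      (\<Sum>k<N. A $$ (i, k) * (\<Sum>m. c k m * z ^ m))"
  proof -
    have sm: "summable (\<lambda>m. c k m * z ^ m)" if "k < N" for k
      unfolding c_def by (rule summable_exp_entry[OF A that ij(2)])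
    have "(\<Sum>m. (\<Sum>k<N. A $$ (i, k) * c k m) * z ^ m) =
        (\<Sum>m. \<Sum>k<N. A $$ (i, k) * (c k m * z ^ m))"
      by (simp add: sum_distrib_right mult.assoc)
    also have "\<dots> = (\<Sum>k<N. \<Sum>m. A $$ (i, k) * (c k m * z ^ m))"
      using sm by (intro suminf_sum summable_mult) auto
    also have "\<dots> = (\<Sum>k<N. A $$ (i, k) * (\<Sum>m. c k m * z ^ m))"
      using sm by (intro sum.cong refl suminf_mult) auto
    finally show ?thesis .
  qed
  ultimately show ?thesis
    by (simp add: exp_entry_def[abs_def] c_def)
qed

section \<open>Schroedinger evolution of the state vector\<close>

lemma evol_carrier: "H \<in> carrier_mat N N \<Longrightarrow> evol H t \<in> carrier_mat N N"
  by (auto simp: evol_def mat_exp_def)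

lemma evol_nth:
  assumes H: "H \<in> carrier_mat N N" and ij: "i < N" "j < N"
  shows "evol H t $$ (i, j) = exp_entry H i j (- \<i> * of_real t)"
  using assms pow_mat_smult_nth[OF assms]
  by (simp add: evol_def mat_exp_def exp_entry_def mult.commute)

definition evol_vec :: "nat \<Rightarrow> complex mat \<Rightarrow> complex vec \<Rightarrow> nat \<Rightarrow> real \<Rightarrow> complex" where
  "evol_vec N H psi i t = (\<Sum>j<N. exp_entry H i j (- \<i> * of_real t) * psi $ j)"

lemma evol_vec_0:
  assumes "H \<in> carrier_mat N N" "i < N"
  shows "evol_vec N H psi i 0 = psi $ i"
proof -
  have "evol_vec N H psi i 0 = (\<Sum>j<N. of_bool (i = j) * psi $ j)"
    unfolding evol_vec_def using assms by (intro sum.cong refl) (simp add: exp_entry_0)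
  also have "\<dots> = psi $ i"
    using assms by (simp add: of_bool_def if_distrib[of "\<lambda>x. x * _"] cong: if_cong)
  finally show ?thesis .
qed

lemma evol_vec_derivative:
  assumes H: "H \<in> carrier_mat N N" and i: "i < N"
  shows "(evol_vec N H psi i has_vector_derivative
    - \<i> * (\<Sum>k<N. H $$ (i, k) * evol_vec N H psi k t)) (at t)"
proof -
  have "((\<lambda>t. exp_entry H i j (- \<i> * of_real t)) has_vector_derivative
      (\<Sum>k<N. H $$ (i, k) * exp_entry H k j (- \<i> * of_real t)) * (- \<i>)) (at t)" if "j < N" for j
  proof (rule has_vector_derivative_real_field)
    have "((\<lambda>z. - \<i> * z) has_field_derivative (- \<i>)) (at (of_real t))"
      by (auto intro!: derivative_eq_intros)
    from DERIV_chain2[OF DERIV_exp_entry[OF H i that] this]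
    show "((\<lambda>z. exp_entry H i j (- \<i> * z)) has_field_derivative
      (\<Sum>k<N. H $$ (i, k) * exp_entry H k j (- \<i> * of_real t)) * (- \<i>)) (at (of_real t))" .
  qed
  then have "(evol_vec N H psi i has_vector_derivative
      (\<Sum>j<N. (\<Sum>k<N. H $$ (i, k) * exp_entry H k j (- \<i> * of_real t)) * (- \<i>) * psi $ j)) (at t)"
    unfolding evol_vec_def[abs_def]
    by (intro has_vector_derivative_sum has_vector_derivative_mult_left) auto
  moreover have "(\<Sum>j<N. (\<Sum>k<N. H $$ (i, k) * exp_entry H k j (- \<i> * of_real t)) * (- \<i>) * psi $ j) =
      - \<i> * (\<Sum>k<N. H $$ (i, k) * evol_vec N H psi k t)"
    unfolding evol_vec_def sum_distrib_left sum_distrib_right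
    by (subst sum.swap) (simp add: mult_ac)
  ultimately show ?thesis by simp
qed

text \<open>Hermiticity of \<open>H\<close> cancels the derivative of the squared norm. The
  difference quotients of the projections are therefore traceless.\<close>

lemma evol_vec_norm_const:
  assumes H: "hermitian_op N H"
  shows "(\<Sum>i<N. evol_vec N H psi i t * cnj (evol_vec N H psi i t)) = (\<Sum>i<N. psi $ i * cnj (psi $ i))"
proof -
  have Hc: "H \<in> carrier_mat N N" using H by (simp add: hermitian_op_def)
  define u where "u = evol_vec N H psi"
  define h where "h i t = (\<Sum>k<N. H $$ (i, k) * u k t)" for i t
  have "((\<lambda>t. Re (\<Sum>i<N. u i t * cnj (u i t))) has_real_derivative 0) (at t)" for t
  proof -
    have du: "(u i has_vector_derivative - \<i> * h i t) (at t)" if "i < N" for i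
      unfolding u_def h_def by (rule evol_vec_derivative[OF Hc that])
    have "((\<lambda>t. \<Sum>i<N. u i t * cnj (u i t)) has_vector_derivative
        (\<Sum>i<N. u i t * cnj (- \<i> * h i t) + (- \<i> * h i t) * cnj (u i t))) (at t)"
      by (intro has_vector_derivative_sum has_vector_derivative_mult has_vector_derivative_cnj du) auto
    also have "(\<Sum>i<N. u i t * cnj (- \<i> * h i t) + (- \<i> * h i t) * cnj (u i t)) =
        \<i> * ((\<Sum>i<N. u i t * cnj (h i t)) - (\<Sum>i<N. h i t * cnj (u i t)))"
      by (simp add: sum.distrib sum_subtractf right_diff_distrib sum_distrib_left sum_negf mult_ac)
    also have "(\<Sum>i<N. u i t * cnj (h i t)) = (\<Sum>i<N. \<Sum>k<N. u i t * (H $$ (k, i) * cnj (u k t)))"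
      unfolding h_def cnj_sum sum_distrib_left
      using hermitian_op_cnj[OF H] by (intro sum.cong refl) simp
    also have "\<dots> = (\<Sum>i<N. h i t * cnj (u i t))"
      unfolding h_def sum_distrib_right by (subst sum.swap) (simp add: mult_ac)
    finally have "((\<lambda>t. \<Sum>i<N. u i t * cnj (u i t)) has_vector_derivative 0) (at t)" by simp
    from bounded_linear.has_vector_derivative[OF bounded_linear_Re this] show ?thesis
      by (simp add: has_real_derivative_iff_has_vector_derivative)
  qed
  then have "Re (\<Sum>i<N. u i t * cnj (u i t)) = Re (\<Sum>i<N. u i 0 * cnj (u i 0))"
    by (intro DERIV_isconst_all) auto
  then have "Re (\<Sum>i<N. u i t * cnj (u i t)) = Re (\<Sum>i<N. psi $ i * cnj (psi $ i))"
    using evol_vec_0[OF Hc] by (simp add: u_def)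
  then show ?thesis by (simp add: u_def complex_eq_iff)
qed

lemma proj_evol_nth:
  assumes H: "H \<in> carrier_mat N N" and psi: "psi \<in> carrier_vec N" and ab: "a < N" "b < N"
  shows "((1 / of_real t) \<cdot>\<^sub>m (proj psi - evol H t * proj psi * adj (evol H t))) $$ (a, b) =
    (psi $ a * cnj (psi $ b) - evol_vec N H psi a t * cnj (evol_vec N H psi b t)) / of_real t"
proof -
  define U where "U = evol H t"
  have U: "U \<in> carrier_mat N N" "adj U \<in> carrier_mat N N" and P: "proj psi \<in> carrier_mat N N"
    using evol_carrier[OF H, of t] psi by (auto simp: U_def adj_def proj_def)
  have u: "evol_vec N H psi i t = (\<Sum>j<N. U $$ (i, j) * psi $ j)" if "i < N" for i
    using evol_nth[OF H that] by (simp add: evol_vec_def U_def)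
  have UP: "(U * proj psi) $$ (a, k) = evol_vec N H psi a t * cnj (psi $ k)" if "k < N" for k
    using mult_mat_nth[OF U(1) P ab(1) that] that psi ab u
    by (simp add: proj_def sum_distrib_right mult.assoc)
  have "(U * proj psi * adj U) $$ (a, b) = (\<Sum>k<N. (U * proj psi) $$ (a, k) * adj U $$ (k, b))"
    using U P ab by (intro mult_mat_nth) auto
  also have "\<dots> = (\<Sum>k<N. evol_vec N H psi a t * cnj (U $$ (b, k) * psi $ k))"
    using U ab UP by (intro sum.cong refl) (simp add: adj_def)
  also have "\<dots> = evol_vec N H psi a t * cnj (evol_vec N H psi b t)"
    using u ab by (simp add: sum_distrib_left)
  finally have "(U * proj psi * adj U) $$ (a, b) = \<dots>" .
  moreover have "proj psi $$ (a, b) = psi $ a * cnj (psi $ b)"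
    using psi ab by (simp add: proj_def)
  ultimately show ?thesis
    using U P ab unfolding U_def[symmetric] by (simp add: adj_def)
qed

text \<open>The initial value comes first, as in \<open>W1_rate\<close>, hence the sign of the
  limit.\<close>

lemma has_vector_derivative_quotient_tendsto:
  fixes f :: "real \<Rightarrow> complex"
  assumes "(f has_vector_derivative D) (at 0)"
  shows "((\<lambda>t. (f 0 - f t) / of_real t) \<longlongrightarrow> - D) (at 0)"
proof -
  have "(\<lambda>t. norm (f (0 + t) - f 0 - t *\<^sub>R D) / norm t) \<midarrow>0\<rightarrow> 0"
    using assms unfolding has_vector_derivative_def has_derivative_at by blast
  then have "(\<lambda>t. norm ((f 0 - f t) / of_real t - (- D))) \<midarrow>0\<rightarrow> 0"
  proof (rule Lim_transform_eventually)
    have "norm (f (0 + t) - f 0 - t *\<^sub>R D) / norm t = norm ((f 0 - f t) / of_real t - (- D))"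
      if "t \<noteq> 0" for t :: real
    proof -
      have "(f 0 - f t) / of_real t - (- D) = - ((f t - f 0 - t *\<^sub>R D) / of_real t)"
        using that by (simp add: field_simps scaleR_conv_of_real)
      then show ?thesis by (simp only: norm_minus_cancel norm_divide) simp
    qed
    then show "\<forall>\<^sub>F t in at 0. norm (f (0 + t) - f 0 - t *\<^sub>R D) / norm t =
        norm ((f 0 - f t) / of_real t - (- D))"
      by (auto simp: eventually_at_filter)
  qed
  then show ?thesis
    by (rule LIM_zero_cancel[OF tendsto_norm_zero_cancel])
qed

lemma proj_evol_tendsto:
  fixes N :: nat and psi :: "complex vec"
  assumes H: "H \<in> carrier_mat N N" and ab: "a < N" "b < N"
  defines "h \<equiv> \<lambda>i. \<Sum>k<N. H $$ (i, k) * psi $ k"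
  shows "((\<lambda>t. (psi $ a * cnj (psi $ b) - evol_vec N H psi a t * cnj (evol_vec N H psi b t)) / of_real t)
    \<longlongrightarrow> \<i> * (h a * cnj (psi $ b) - psi $ a * cnj (h b))) (at 0)"
proof -
  define u where "u = evol_vec N H psi"
  have u0: "u i 0 = psi $ i" if "i < N" for i unfolding u_def by (rule evol_vec_0[OF H that])
  have du: "(u i has_vector_derivative - \<i> * h i) (at 0)" if "i < N" for i
    using evol_vec_derivative[OF H that, of psi 0] u0 by (simp add: h_def u_def)
  have "((\<lambda>t. u a t * cnj (u b t)) has_vector_derivative
      (u a 0 * cnj (- \<i> * h b) + (- \<i> * h a) * cnj (u b 0))) (at 0)"
    using ab by (intro has_vector_derivative_mult has_vector_derivative_cnj du)
  from has_vector_derivative_quotient_tendsto[OF this] show ?thesis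
    using u0 ab by (simp add: u_def algebra_simps)
qed

section \<open>The Wasserstein norm and its rate\<close>

definition W1_feasible :: "nat \<Rightarrow> nat \<Rightarrow> complex mat \<Rightarrow> (nat \<Rightarrow> complex mat) \<Rightarrow> bool" where
  "W1_feasible d n A X \<longleftrightarrow>
    (\<forall>i<n. X i \<in> traceless_herm d n \<and> ptrace_zero d n i (X i)) \<and>
    (\<forall>a<d ^ n. \<forall>b<d ^ n. A $$ (a, b) = (\<Sum>i<n. X i $$ (a, b)))"

lemma W1_norm_feasible:
  "W1_norm d n A = (1/2) * Inf {(\<Sum>i<n. trace_norm (X i)) | X. W1_feasible d n A X}"
  by (simp add: W1_norm_def W1_feasible_def)

lemma W1_feasible_sum_nonneg:
  "W1_feasible d n A X \<Longrightarrow> 0 \<le> (\<Sum>i<n. trace_norm (X i))"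
  by (intro sum_nonneg trace_norm_nonneg[of "d ^ n"])
     (auto simp: W1_feasible_def traceless_herm_def)

lemma W1_norm_le:
  assumes "W1_feasible d n A X"
  shows "2 * W1_norm d n A \<le> (\<Sum>i<n. trace_norm (X i))"
proof -
  have "bdd_below {(\<Sum>i<n. trace_norm (X i)) | X. W1_feasible d n A X}"
    by (rule bdd_belowI[of _ 0]) (auto intro: W1_feasible_sum_nonneg)
  then have "Inf {(\<Sum>i<n. trace_norm (X i)) | X. W1_feasible d n A X} \<le> (\<Sum>i<n. trace_norm (X i))"
    using assms by (intro cInf_lower) auto
  then show ?thesis by (simp add: W1_norm_feasible)
qed

text \<open>The witness \<open>X0\<close> makes the set nonempty, so that its infimum inherits the
  lower bound \<open>r\<close>.\<close>

lemma W1_norm_ge: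
  assumes "W1_feasible d n A X0"
    and "\<And>X. W1_feasible d n A X \<Longrightarrow> r \<le> (\<Sum>i<n. trace_norm (X i))"
  shows "r \<le> 2 * W1_norm d n A"
  unfolding W1_norm_feasible using assms by (auto intro!: cInf_greatest)

lemma mat_traceless_herm:
  assumes "\<And>a b. a < d ^ n \<Longrightarrow> b < d ^ n \<Longrightarrow> cnj (f b a) = f a b" and "(\<Sum>a<d ^ n. f a a) = 0"
  shows "mat (d ^ n) (d ^ n) (\<lambda>(a, b). f a b) \<in> traceless_herm d n"
  using assms(2) hermitian_opI[of "d ^ n" f, OF assms(1)]
  by (simp add: traceless_herm_def mtrace_def)

lemma traceless_herm_trace:
  "A \<in> traceless_herm d n \<Longrightarrow> (\<Sum>a<d ^ n. A $$ (a, a)) = 0"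
  by (auto simp: traceless_herm_def mtrace_def hermitian_op_def)

lemma traceless_herm_cnj:
  "A \<in> traceless_herm d n \<Longrightarrow> a < d ^ n \<Longrightarrow> b < d ^ n \<Longrightarrow> cnj (A $$ (b, a)) = A $$ (a, b)"
  by (auto simp: traceless_herm_def intro: hermitian_op_cnj)

lemma mat_ptrace_zero:
  assumes "i < n"
    and "\<And>a b. a < d ^ n \<Longrightarrow> b < d ^ n \<Longrightarrow> qdigit d i a = 0 \<Longrightarrow> qdigit d i b = 0 \<Longrightarrow>
      (\<Sum>j<d. f (a + j * d ^ i) (b + j * d ^ i)) = 0"
  shows "ptrace_zero d n i (mat (d ^ n) (d ^ n) (\<lambda>(a, b). f a b))"
  using assms qdigit_add_shift(1)[of _ d n i] by (simp add: ptrace_zero_def)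

text \<open>Consecutive stages of depolarization share the partial trace over the qudit treated
  between them. Every stage has trace norm at most \<open>t\<close>, so a difference of two costs at
  most \<open>2 * t\<close>.\<close>

lemma W1_feasible_depol:
  assumes d: "0 < d" and S: "S \<subseteq> {..<n}" and A: "A \<in> traceless_herm d n"
    and zero: "\<And>a b. a < d ^ n \<Longrightarrow> b < d ^ n \<Longrightarrow> depol d n S (\<lambda>a b. A $$ (a, b)) a b = 0"
    and t: "split_bound (d ^ n) (\<lambda>a b. A $$ (a, b)) t"
  shows "\<exists>X. W1_feasible d n A X \<and> (\<Sum>i<n. trace_norm (X i)) \<le> 2 * real (card S) * t"
proof -
  define N where "N = d ^ n"
  define f where "f a b = A $$ (a, b)" for a b
  \<comment> \<open>At stage \<open>i\<close> the members of \<open>S\<close> below \<open>i\<close>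
    have been treated. For \<open>i\<close> outside \<open>S\<close> nothing changes and
    \<open>X i\<close> is zero, so the cost counts \<open>card S\<close> terms although the family
    has \<open>n\<close> members.\<close>
  define D where "D i = depol d n (S \<inter> {..<i}) f" for i
  define X where "X i = mat N N (\<lambda>(a, b). D i a b - D (Suc i) a b)" for i
  have f: "cnj (f b a) = f a b" if "a < d ^ n" "b < d ^ n" for a b
    unfolding f_def using A that by (rule traceless_herm_cnj)
  have D_cnj: "cnj (D i b a) = D i a b" for i a b
    unfolding D_def by (rule cnj_depol[OF d f])
  have D_trace: "(\<Sum>a<N. D i a a) = 0" for i
    unfolding D_def N_def sum_depol_diag[OF d] using traceless_herm_trace[OF A] by (simp add: f_def)
  have Xth: "X i \<in> traceless_herm d n" for i
    unfolding X_def N_def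
    by (rule mat_traceless_herm) (use D_cnj D_trace in \<open>simp_all add: sum_subtractf N_def\<close>)
  have D_skip: "D (Suc i) = D i" if "i \<notin> S" for i
  proof -
    have "S \<inter> {..<Suc i} = S \<inter> {..<i}" using that by (auto simp: less_Suc_eq)
    then show ?thesis by (simp add: D_def)
  qed
  have pt: "ptrace_zero d n i (X i)" if i: "i < n" for i
    unfolding X_def N_def
  proof (rule mat_ptrace_zero[OF i])
    fix a b assume ab: "a < d ^ n" "b < d ^ n" "qdigit d i a = 0" "qdigit d i b = 0"
    have "(\<Sum>j<d. D i (a + j * d ^ i) (b + j * d ^ i)) = (\<Sum>j<d. D (Suc i) (a + j * d ^ i) (b + j * d ^ i))"
    proof (cases "i \<in> S")
      case True
      then have "S \<inter> {..<Suc i} = insert i (S \<inter> {..<i})" by auto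
      then show ?thesis
        unfolding D_def using sum_depol_insert[OF d i _ ab(1,3,2,4), of "S \<inter> {..<i}" f] by simp
    qed (simp add: D_skip)
    then show "(\<Sum>j<d. D i (a + j * d ^ i) (b + j * d ^ i) - D (Suc i) (a + j * d ^ i) (b + j * d ^ i)) = 0"
      by (simp add: sum_subtractf)
  qed
  have tel: "(\<Sum>i<n. X i $$ (a, b)) = A $$ (a, b)" if "a < d ^ n" "b < d ^ n" for a b
  proof -
    have "(\<Sum>i<n. X i $$ (a, b)) = (\<Sum>i<n. D i a b - D (Suc i) a b)"
      using that by (simp add: X_def N_def)
    also have "\<dots> = D 0 a b - D n a b"
      by (rule sum_lessThan_telescope')
    also have "D n a b = 0"
      using zero[OF that] S by (simp add: D_def f_def[abs_def] Int_absorb2)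
    also have "D 0 a b = A $$ (a, b)"
      using depol_empty[OF d that] by (simp add: D_def f_def)
    finally show ?thesis by simp
  qed
  have tn: "trace_norm (X i) \<le> (if i \<in> S then 2 * t else 0)" for i
  proof -
    have herm: "hermitian_op N (X i)" using Xth by (auto simp: traceless_herm_def N_def)
    have sb: "split_bound N (D i) t" for i
      unfolding D_def N_def by (rule split_bound_depol[OF d]) (use t in \<open>simp add: f_def[abs_def]\<close>)
    have "split_bound N (\<lambda>a b. X i $$ (a, b)) (if i \<in> S then 2 * t else 0)"
    proof (cases "i \<in> S")
      case True
      have "split_bound N (\<lambda>a b. D i a b + - D (Suc i) a b) (t + t)"
        by (intro split_bound_add split_bound_uminus sb)
      then show ?thesis using True unfolding split_bound_def by (simp add: X_def)
    next
      case False
      have "accretive N (\<lambda>a b. 0)" by (simp add: accretive_def quad_def)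
      then show ?thesis
        unfolding split_bound_def
        by (intro exI[of _ "\<lambda>a b. 0"]) (use False in \<open>simp add: X_def D_skip\<close>)
    qed
    then show ?thesis by (simp add: trace_norm_le_iff[OF herm])
  qed
  have "(\<Sum>i<n. trace_norm (X i)) \<le> (\<Sum>i<n. if i \<in> S then 2 * t else 0)"
    using tn by (intro sum_mono)
  also have "\<dots> = (\<Sum>i\<in>S. 2 * t)"
    using S by (simp add: sum.If_cases Int_absorb1)
  finally have "(\<Sum>i<n. trace_norm (X i)) \<le> 2 * real (card S) * t" by (simp add: mult_ac)
  then show ?thesis
    using Xth pt tel unfolding W1_feasible_def by (intro exI[of _ X]) auto
qed

lemma W1_norm_depol_le:
  assumes "0 < d" "S \<subseteq> {..<n}" "A \<in> traceless_herm d n"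
    and "\<And>a b. a < d ^ n \<Longrightarrow> b < d ^ n \<Longrightarrow> depol d n S (\<lambda>a b. A $$ (a, b)) a b = 0"
    and "split_bound (d ^ n) (\<lambda>a b. A $$ (a, b)) t"
  shows "W1_norm d n A \<le> real (card S) * t"
proof -
  obtain X where "W1_feasible d n A X" "(\<Sum>i<n. trace_norm (X i)) \<le> 2 * real (card S) * t"
    using W1_feasible_depol[OF assms] by blast
  then show ?thesis using W1_norm_le[of d n A X] by simp
qed

section \<open>Continuity of the Wasserstein norm in the matrix entries\<close>

lemma norm_quad_le:
  "cmod (quad N f v) \<le> (\<Sum>a<N. \<Sum>b<N. cmod (f a b)) * (\<Sum>a<N. (cmod (v a))\<^sup>2)"
proof -
  define s where "s = (\<Sum>a<N. (cmod (v a))\<^sup>2)"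
  have "cmod (cnj (v a) * f a b * v b) \<le> cmod (f a b) * s" if "a < N" "b < N" for a b
  proof -
    have "(cmod (v a))\<^sup>2 \<le> s" "(cmod (v b))\<^sup>2 \<le> s"
      unfolding s_def using that by (auto intro!: member_le_sum)
    moreover have "2 * (cmod (v a) * cmod (v b)) \<le> (cmod (v a))\<^sup>2 + (cmod (v b))\<^sup>2"
      using sum_squares_bound[of "cmod (v a)" "cmod (v b)"] by (simp add: mult_ac)
    ultimately have "cmod (v a) * cmod (v b) \<le> s" by linarith
    from mult_left_mono[OF this, of "cmod (f a b)"] show ?thesis
      by (simp add: norm_mult mult_ac)
  qed
  then have "cmod (quad N f v) \<le> (\<Sum>a<N. \<Sum>b<N. cmod (f a b) * s)"
    unfolding quad_def by (intro sum_norm_le) simp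
  then show ?thesis by (simp add: s_def[symmetric] sum_distrib_right)
qed

text \<open>Shifting by \<open>c\<close> times the identity, with \<open>c\<close> the sum of all
  moduli, dominates the form of \<open>f\<close>; trace zero leaves only the cost of the shift. The
  bound is crude but tends to zero with the entries.\<close>

lemma split_bound_entries:
  assumes "(\<Sum>a<N. f a a) = 0"
  shows "split_bound N f (2 * real N * (\<Sum>a<N. \<Sum>b<N. cmod (f a b)))"
proof -
  define c where "c = (\<Sum>a<N. \<Sum>b<N. cmod (f a b))"
  define g where "g a b = (if a = b then complex_of_real c else 0)" for a b :: nat
  have c: "0 \<le> c" unfolding c_def by (intro sum_nonneg) simp
  have g: "Re (quad N g v) = c * (\<Sum>a<N. (cmod (v a))\<^sup>2)" for v
  proof -
    have "quad N g v = (\<Sum>a<N. \<Sum>b<N. if a = b then of_real c * (cnj (v a) * v a) else 0)"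
      unfolding quad_def by (intro sum.cong refl) (simp add: g_def)
    also have "\<dots> = (\<Sum>a<N. of_real c * (cnj (v a) * v a))"
      by simp
    also have "\<dots> = of_real (c * (\<Sum>a<N. (cmod (v a))\<^sup>2))"
      by (simp only: sum_distrib_left[symmetric] sum_cnj_mult_self of_real_mult)
    finally show ?thesis by simp
  qed
  have "accretive N g" unfolding accretive_def g using c by (auto intro!: mult_nonneg_nonneg sum_nonneg)
  moreover have "accretive N (\<lambda>a b. f a b + g a b)"
    unfolding accretive_def
  proof
    fix v
    have "quad N (\<lambda>a b. f a b + g a b) v = quad N f v + quad N g v"
      by (simp add: quad_def algebra_simps sum.distrib)
    moreover have "\<bar>Re (quad N f v)\<bar> \<le> c * (\<Sum>a<N. (cmod (v a))\<^sup>2)"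
      using norm_quad_le[of N f v] abs_Re_le_cmod[of "quad N f v"] by (simp add: c_def)
    ultimately show "0 \<le> Re (quad N (\<lambda>a b. f a b + g a b) v)" using g[of v] by simp
  qed
  moreover have "(\<Sum>a<N. Re (f a a + g a a) + Re (g a a)) \<le> 2 * real N * c"
    using arg_cong[OF assms, of Re] by (simp add: g_def sum.distrib)
  ultimately show ?thesis
    unfolding split_bound_def c_def[symmetric]
    by (intro exI[of _ "\<lambda>a b. f a b + g a b"] exI[of _ g]) simp
qed

lemma traceless_herm_feasible:
  assumes "0 < d" "A \<in> traceless_herm d n"
  shows "\<exists>X. W1_feasible d n A X"
    and "W1_norm d n A \<le> real n * (2 * real (d ^ n) * (\<Sum>a<d ^ n. \<Sum>b<d ^ n. cmod (A $$ (a, b))))"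
proof -
  note tr = traceless_herm_trace[OF assms(2)]
  have zero: "depol d n {..<n} (\<lambda>a b. A $$ (a, b)) a b = 0" for a b
    using tr by (intro depol_all assms(1))
  have sb: "split_bound (d ^ n) (\<lambda>a b. A $$ (a, b))
      (2 * real (d ^ n) * (\<Sum>a<d ^ n. \<Sum>b<d ^ n. cmod (A $$ (a, b))))"
    using tr by (rule split_bound_entries)
  show "\<exists>X. W1_feasible d n A X"
    using W1_feasible_depol[OF assms(1) order_refl assms(2) zero sb] by blast
  show "W1_norm d n A \<le> real n * (2 * real (d ^ n) * (\<Sum>a<d ^ n. \<Sum>b<d ^ n. cmod (A $$ (a, b))))"
    using W1_norm_depol_le[OF assms(1) order_refl assms(2) zero sb] by simp
qed

lemma W1_norm_triangle:
  assumes d: "0 < d" and A: "A \<in> traceless_herm d n" and B: "B \<in> traceless_herm d n"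
    and C: "\<And>a b. a < d ^ n \<Longrightarrow> b < d ^ n \<Longrightarrow> C $$ (a, b) = A $$ (a, b) + B $$ (a, b)"
  shows "W1_norm d n C \<le> W1_norm d n A + W1_norm d n B"
proof -
  have le: "2 * W1_norm d n C \<le> (\<Sum>i<n. trace_norm (X i)) + (\<Sum>i<n. trace_norm (Y i))"
    if X: "W1_feasible d n A X" and Y: "W1_feasible d n B Y" for X Y
  proof -
    define Z where "Z i = mat (d ^ n) (d ^ n) (\<lambda>(a, b). X i $$ (a, b) + Y i $$ (a, b))" for i
    have Xi: "X i \<in> traceless_herm d n" "ptrace_zero d n i (X i)"
      and Yi: "Y i \<in> traceless_herm d n" "ptrace_zero d n i (Y i)" if "i < n" for i
      using X Y that by (auto simp: W1_feasible_def)
    have Zi: "Z i \<in> traceless_herm d n" if "i < n" for i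
      unfolding Z_def by (rule mat_traceless_herm)
        (use Xi[OF that] Yi[OF that] in \<open>simp_all add: traceless_herm_cnj traceless_herm_trace sum.distrib\<close>)
    have "ptrace_zero d n i (Z i)" if "i < n" for i
      unfolding Z_def by (rule mat_ptrace_zero[OF that])
        (use Xi[OF that] Yi[OF that] in \<open>simp add: ptrace_zero_def sum.distrib\<close>)
    then have "W1_feasible d n C Z"
      using X Y Zi C by (simp add: W1_feasible_def Z_def sum.distrib)
    then have "2 * W1_norm d n C \<le> (\<Sum>i<n. trace_norm (Z i))" by (rule W1_norm_le)
    also have "\<dots> \<le> (\<Sum>i<n. trace_norm (X i) + trace_norm (Y i))"
    proof (rule sum_mono)
      fix i assume "i \<in> {..<n}"
      then have i: "i < n" by simp
      have h: "hermitian_op (d ^ n) (X i)" "hermitian_op (d ^ n) (Y i)" "hermitian_op (d ^ n) (Z i)"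
        using Xi[OF i] Yi[OF i] Zi[OF i] by (auto simp: traceless_herm_def)
      have "split_bound (d ^ n) (\<lambda>a b. X i $$ (a, b) + Y i $$ (a, b)) (trace_norm (X i) + trace_norm (Y i))"
        using trace_norm_le_iff[OF h(1)] trace_norm_le_iff[OF h(2)]
        by (intro split_bound_add) blast+
      then have "split_bound (d ^ n) (\<lambda>a b. Z i $$ (a, b)) (trace_norm (X i) + trace_norm (Y i))"
        unfolding split_bound_def by (simp add: Z_def)
      then show "trace_norm (Z i) \<le> trace_norm (X i) + trace_norm (Y i)"
        using trace_norm_le_iff[OF h(3)] by blast
    qed
    finally show ?thesis by (simp add: sum.distrib)
  qed
  obtain X0 Y0 where X0: "W1_feasible d n A X0" and Y0: "W1_feasible d n B Y0"
    using traceless_herm_feasible(1)[OF d] A B by blast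
  \<comment> \<open>The infimum over \<open>X\<close> is taken with \<open>Y\<close> fixed; the
    infimum over \<open>Y\<close> comes afterwards.\<close>
  have "2 * W1_norm d n C - (\<Sum>i<n. trace_norm (Y i)) \<le> 2 * W1_norm d n A"
    if "W1_feasible d n B Y" for Y
    using le[OF _ that] by (intro W1_norm_ge[OF X0]) (simp add: algebra_simps)
  then have "2 * W1_norm d n C - 2 * W1_norm d n A \<le> 2 * W1_norm d n B"
    by (intro W1_norm_ge[OF Y0]) (simp add: algebra_simps)
  then show ?thesis by simp
qed

lemma W1_norm_diff_le:
  assumes d: "0 < d" and A: "A \<in> traceless_herm d n" and B: "B \<in> traceless_herm d n"
  shows "W1_norm d n A - W1_norm d n B \<le>
    real n * (2 * real (d ^ n) * (\<Sum>a<d ^ n. \<Sum>b<d ^ n. cmod (A $$ (a, b) - B $$ (a, b))))"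
proof -
  define E where "E = mat (d ^ n) (d ^ n) (\<lambda>(a, b). A $$ (a, b) - B $$ (a, b))"
  have E: "E \<in> traceless_herm d n"
    unfolding E_def by (rule mat_traceless_herm)
      (use A B in \<open>simp_all add: traceless_herm_cnj traceless_herm_trace sum_subtractf\<close>)
  have "W1_norm d n A \<le> W1_norm d n B + W1_norm d n E"
    by (rule W1_norm_triangle[OF d B E]) (simp add: E_def)
  moreover have "(\<Sum>a<d ^ n. \<Sum>b<d ^ n. cmod (E $$ (a, b))) =
      (\<Sum>a<d ^ n. \<Sum>b<d ^ n. cmod (A $$ (a, b) - B $$ (a, b)))"
    by (simp add: E_def)
  ultimately show ?thesis
    using traceless_herm_feasible(2)[OF d E] by simp
qed

lemma W1_norm_tendsto:
  assumes d: "0 < d" and A: "A \<in> traceless_herm d n"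
    and B: "eventually (\<lambda>t. B t \<in> traceless_herm d n) F"
    and lim: "\<And>a b. a < d ^ n \<Longrightarrow> b < d ^ n \<Longrightarrow> ((\<lambda>t. B t $$ (a, b)) \<longlongrightarrow> A $$ (a, b)) F"
  shows "((\<lambda>t. W1_norm d n (B t)) \<longlongrightarrow> W1_norm d n A) F"
proof -
  define g where "g t = real n * (2 * real (d ^ n) *
    (\<Sum>a<d ^ n. \<Sum>b<d ^ n. cmod (B t $$ (a, b) - A $$ (a, b))))" for t
  have "(g \<longlongrightarrow> real n * (2 * real (d ^ n) * (\<Sum>a<d ^ n. \<Sum>b<d ^ n. cmod (A $$ (a, b) - A $$ (a, b))))) F"
    unfolding g_def[abs_def] using lim by (intro tendsto_intros) auto
  then have g: "(g \<longlongrightarrow> 0) F" by simp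
  show ?thesis
  proof (rule tendsto_sandwich)
    show "\<forall>\<^sub>F t in F. W1_norm d n A - g t \<le> W1_norm d n (B t)"
      using B
    proof eventually_elim
      case (elim t)
      show ?case using W1_norm_diff_le[OF d A elim] by (simp add: g_def norm_minus_commute)
    qed
    show "\<forall>\<^sub>F t in F. W1_norm d n (B t) \<le> W1_norm d n A + g t"
      using B
    proof eventually_elim
      case (elim t)
      show ?case using W1_norm_diff_le[OF d elim A] by (simp add: g_def)
    qed
    show "((\<lambda>t. W1_norm d n A - g t) \<longlongrightarrow> W1_norm d n A) F"
      using tendsto_diff[OF tendsto_const g] by simp
    show "((\<lambda>t. W1_norm d n A + g t) \<longlongrightarrow> W1_norm d n A) F"
      using tendsto_add[OF tendsto_const g] by simp
  qed
qed

text \<open>Row sums of moduli bound the images of all unit vectors, so the supremum in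
  \<open>op_norm\<close> is a genuine upper bound.\<close>

lemma vnorm_mult_le_op_norm:
  assumes A: "A \<in> carrier_mat N N" and v: "v \<in> carrier_vec N" "vnorm v = 1"
  shows "vnorm (A *\<^sub>v v) \<le> op_norm A"
proof -
  have "vnorm (A *\<^sub>v w) \<le> sqrt (\<Sum>i<N. (\<Sum>j<N. cmod (A $$ (i, j)))\<^sup>2)"
    if w: "w \<in> carrier_vec N" "vnorm w = 1" for w
  proof -
    have w1: "cmod (w $ j) \<le> 1" if "j < N" for j
    proof -
      have "(\<Sum>i<N. (cmod (w $ i))\<^sup>2) = 1" using w by (simp add: vnorm_def)
      moreover have "(cmod (w $ j))\<^sup>2 \<le> (\<Sum>i<N. (cmod (w $ i))\<^sup>2)"
        using that by (intro member_le_sum) auto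
      ultimately show ?thesis by (simp add: power_le_one_iff abs_square_le_1)
    qed
    have "cmod ((A *\<^sub>v w) $ i) \<le> (\<Sum>j<N. cmod (A $$ (i, j)))" if "i < N" for i
      unfolding mult_mat_vec_nth[OF A w(1) that]
      using w1 by (intro sum_norm_le) (simp add: norm_mult mult_left_le)
    then show ?thesis
      using A by (auto simp: vnorm_def intro!: sum_mono power_mono)
  qed
  then have "bdd_above {vnorm (A *\<^sub>v v) | v. v \<in> carrier_vec (dim_col A) \<and> vnorm v = 1}"
    using A by (intro bdd_aboveI) auto
  then show ?thesis
    unfolding op_norm_def using A v by (intro cSup_upper) auto
qed

text \<open>With \<open>u\<^sub>\<plusminus> = c p \<plusminus> \<i> h\<close>, the matrix is \<open>(u\<^sub>+ u\<^sub>+\<^sup>* - u\<^sub>- u\<^sub>-\<^sup>*) / (2 c)\<close>.\<close>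

lemma split_bound_rank_two:
  assumes p: "(\<Sum>a<N. (cmod (p a))\<^sup>2) \<le> 1" and h: "(\<Sum>a<N. (cmod (h a))\<^sup>2) \<le> c\<^sup>2" and c: "0 \<le> c"
  shows "split_bound N (\<lambda>a b. \<i> * (h a * cnj (p b) - p a * cnj (h b))) (2 * c)"
proof (cases "c = 0")
  case True
  then have "(\<Sum>a<N. (cmod (h a))\<^sup>2) \<le> 0" using h by simp
  then have "(\<Sum>a<N. (cmod (h a))\<^sup>2) = 0"
    by (rule antisym) (simp add: sum_nonneg)
  then have "h a = 0" if "a < N" for a
    using that by (simp add: sum_nonneg_eq_0_iff)
  moreover have "accretive N (\<lambda>a b. 0)" by (simp add: accretive_def quad_def)
  ultimately show ?thesis
    unfolding split_bound_def using True by (intro exI[of _ "\<lambda>a b. 0"]) simp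
next
  case False
  with c have c: "0 < c" by simp
  define u where "u s a = of_real c * p a + s * \<i> * h a" for s a
  define P where "P s a b = of_real (1 / (2 * c)) * u s a * cnj (u s b)" for s a b
  have acc: "accretive N (P s)" for s
    using accretive_spectral[of "{s}" "\<lambda>_. 1 / (2 * c)" N u] c by (simp add: P_def[abs_def])
  have eq: "\<i> * (h a * cnj (p b) - p a * cnj (h b)) = P 1 a b - P (- 1) a b" for a b
    using c by (simp add: P_def u_def field_simps)
  have "Re (P 1 a a) + Re (P (- 1) a a) = c * (cmod (p a))\<^sup>2 + (cmod (h a))\<^sup>2 / c" for a
  proof -
    have "P 1 a a + P (- 1) a a = of_real c * (p a * cnj (p a)) + (h a * cnj (h a)) / of_real c"
      using c by (simp add: P_def u_def field_simps power2_eq_square)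
    also have "\<dots> = of_real (c * (cmod (p a))\<^sup>2 + (cmod (h a))\<^sup>2 / c)"
      by (simp flip: complex_norm_square)
    finally show ?thesis by (simp add: complex_eq_iff)
  qed
  then have "(\<Sum>a<N. Re (P 1 a a) + Re (P (- 1) a a)) =
      c * (\<Sum>a<N. (cmod (p a))\<^sup>2) + (\<Sum>a<N. (cmod (h a))\<^sup>2) / c"
    by (simp add: sum.distrib sum_distrib_left sum_divide_distrib)
  \<comment> \<open>The factor \<open>c\<close> in front of \<open>p\<close> balances the two
    summands: each is at most \<open>c\<close>.\<close>
  also have "\<dots> \<le> c * 1 + c\<^sup>2 / c"
    using p h c by (intro add_mono mult_left_mono divide_right_mono) auto
  also have "\<dots> = 2 * c" using c by (simp add: power2_eq_square)
  finally show ?thesis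
    unfolding split_bound_def using acc eq by (intro exI[of _ "P 1"] exI[of _ "P (- 1)"]) auto
qed

theorem theorem1:
  fixes d n k :: nat and S :: "nat set" and H :: "complex mat" and psi :: "complex vec"
  assumes "d \<ge> 2"
    and "hermitian_op (d ^ n) H"
    and "S \<subseteq> {..<n}" and "card S = k" and "acts_only_on d n S H"
    and "psi \<in> carrier_vec (d ^ n)" and "vnorm psi = 1"
  shows "W1_rate d n psi H \<le> 2 * sqrt 2 * real k * op_norm H"
proof -
  have d: "0 < d" using assms(1) by simp
  define N where "N = d ^ n"
  note H = assms(2)[folded N_def] and psi = assms(6)[folded N_def]
  have Hc: "H \<in> carrier_mat N N" using H by (simp add: hermitian_op_def)
  define h where "h i = (\<Sum>k<N. H $$ (i, k) * psi $ k)" for i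
  define u where "u = evol_vec N H psi"
  define f where "f a b = \<i> * (h a * cnj (psi $ b) - psi $ a * cnj (h b))" for a b
  define A where "A = mat N N (\<lambda>(a, b). f a b)"
  define B where "B t = (1 / of_real t) \<cdot>\<^sub>m (proj psi - evol H t * proj psi * adj (evol H t))" for t :: real
  have B_nth: "B t $$ (a, b) = (psi $ a * cnj (psi $ b) - u a t * cnj (u b t)) / of_real t"
    if "a < N" "b < N" for a b t
    unfolding B_def u_def by (rule proj_evol_nth[OF Hc psi that])
  \<comment> \<open>This includes \<open>t = 0\<close>, where division by zero makes the matrix
    zero.\<close>
  have B: "B t \<in> traceless_herm d n" for t
  proof -
    have "B t \<in> carrier_mat N N"
      using psi evol_carrier[OF Hc, of t] by (auto simp: B_def proj_def adj_def)
    then have "B t = mat N N (\<lambda>(a, b). (psi $ a * cnj (psi $ b) - u a t * cnj (u b t)) / of_real t)"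
      using B_nth by (intro eq_matI) auto
    also have "\<dots> \<in> traceless_herm d n"
      unfolding N_def
    proof (rule mat_traceless_herm)
      show "(\<Sum>a<d ^ n. (psi $ a * cnj (psi $ a) - u a t * cnj (u a t)) / of_real t) = 0"
        using evol_vec_norm_const[OF H, of psi t]
        by (simp add: u_def N_def sum_subtractf flip: sum_divide_distrib)
    qed (simp add: mult.commute)
    finally show ?thesis .
  qed
  have depol0: "depol d n S f a b = 0" if "a < N" "b < N" for a b
    using depol_commutator[OF d assms(3,2,5), of a b "\<lambda>z. psi $ z"] that
    by (simp add: depol_def f_def h_def N_def sum_subtractf flip: sum_distrib_left)
  have A: "A \<in> traceless_herm d n"
    unfolding A_def N_def
  proof (rule mat_traceless_herm)
    \<comment> \<open>The trace of \<open>A\<close> is the limit of the traces of the quotients, all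
      of which are zero.\<close>
    have "((\<lambda>t. \<Sum>a<N. B t $$ (a, a)) \<longlongrightarrow> (\<Sum>a<N. f a a)) (at 0)"
      using proj_evol_tendsto[OF Hc, of _ _ psi] B_nth
      by (intro tendsto_sum) (simp add: u_def f_def h_def)
    moreover have "(\<Sum>a<N. B t $$ (a, a)) = 0" for t
      using traceless_herm_trace[OF B] by (simp add: N_def)
    ultimately show "(\<Sum>a<d ^ n. f a a) = 0"
      by (simp add: N_def tendsto_const_iff)
  qed (simp add: f_def algebra_simps)
  have "((\<lambda>t. W1_norm d n (B t)) \<longlongrightarrow> W1_norm d n A) (at 0)"
  proof (rule W1_norm_tendsto[OF d A])
    fix a b assume "a < d ^ n" "b < d ^ n"
    then show "((\<lambda>t. B t $$ (a, b)) \<longlongrightarrow> A $$ (a, b)) (at 0)"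
      using proj_evol_tendsto[OF Hc, of a b psi] B_nth[of a b]
      by (simp add: A_def u_def f_def h_def N_def)
  qed (simp add: B)
  then have rate: "W1_rate d n psi H = W1_norm d n A"
    unfolding W1_rate_def B_def by (intro tendsto_Lim) auto
  define c where "c = op_norm H"
  have vh: "vnorm (H *\<^sub>v psi) = sqrt (\<Sum>a<N. (cmod (h a))\<^sup>2)"
    using Hc mult_mat_vec_nth[OF Hc psi] by (simp add: vnorm_def h_def)
  have vc: "vnorm (H *\<^sub>v psi) \<le> c"
    unfolding c_def by (rule vnorm_mult_le_op_norm[OF Hc psi assms(7)])
  have "0 \<le> vnorm (H *\<^sub>v psi)" unfolding vh by (auto intro: sum_nonneg)
  with vc have c: "0 \<le> c" by linarith
  have "(\<Sum>a<N. (cmod (psi $ a))\<^sup>2) \<le> 1"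
    using assms(7) psi by (simp add: vnorm_def)
  moreover have "(\<Sum>a<N. (cmod (h a))\<^sup>2) \<le> c\<^sup>2"
    using vc unfolding vh by (rule sqrt_le_D)
  ultimately have "split_bound N f (2 * c)"
    unfolding f_def[abs_def] using c by (rule split_bound_rank_two)
  then have sb: "split_bound (d ^ n) (\<lambda>a b. A $$ (a, b)) (2 * c)"
    unfolding split_bound_def by (simp add: A_def N_def)
  have "depol d n S (\<lambda>a b. A $$ (a, b)) a b = depol d n S f a b" for a b
    by (simp add: depol_def A_def N_def digit_merge_less[OF d])
  then have "W1_norm d n A \<le> real k * (2 * c)"
    using W1_norm_depol_le[OF d assms(3) A _ sb] depol0 assms(4) by (simp add: N_def)
  \<comment> \<open>The factor \<open>1\<close> is made explicit in order to be replaced by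
    \<open>sqrt 2\<close>, which weakens the constant \<open>2\<close> to the stated one.\<close>
  also have "\<dots> = 1 * (real k * (2 * c))" by simp
  also have "\<dots> \<le> sqrt 2 * (real k * (2 * c))"
    using c by (intro mult_right_mono) auto
  finally show ?thesis unfolding rate c_def by (simp add: mult_ac)
qed

end
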